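(* Let $m,n$ be positive integers and let $\rho$ be the sum of $m$ standard representations of $\mathfrak{sl}(n)$ (over $\mathbb{C}$). 1. Assume $m<n$. Write $m=q(n-m)+r$ with $q,r\in\mathbb{Z}$, $0\le r<n-m$. Then the Jordan--Kronecker invariants of $\rho$ consist of $n(n-m)-1$ horizontal indices: $q+1$ taken $n(n-m-r)-(q+1)$ times and $q+2$ taken $nr+q$ times. 2. Assume $m=n$. Then the Jordan--Kronecker invariants of $\rho$ consist of one vertical index $\mathrm{v}_1=n$, and $n$ distinct eigenvalues with $n-1$ Jordan $1\times1$ blocks corresponding to each eigenvalue. 3. Assume $m>n$. Write $n=q(m-n)+r$ with $q,r\in\mathbb{Z}$, $0\le r<m-n$. Then the Jordan--Kronecker invariants of $\rho$ consist of the following $n(m-n)+1$ vertical indices: - if $r\neq0$: $q+1$ taken $n(m-n-r)+(q+2)$ times and $q+2$ taken $nr-(q+1)$ times; - if $r=0$: $q$ taken $q+1$ times and $q+1$ taken $n(m-n)-q$ times. In each case there are no other blocks.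
   Context: Everything is over $\mathbb{C}$ and finite-dimensional. Pencils. For linear maps $A,B:U\to V$ there are bases of $U$ and $V$ (Kronecker's theorem) in which all matrices $A+\lambda B$ are simultaneously block-diagonal, each pair of diagonal blocks $(A_i,B_i)$ being one of: (i) a $k\times k$ Jordan block with eigenvalue $\lambda_0\in\mathbb{C}$: $A_i=J_k(\lambda_0)$ (the upper triangular Jordan block), $B_i=I_k$; (ii) a $k\times k$ Jordan block with eigenvalue $\infty$: $A_i=I_k$, $B_i=J_k(0)$; (iii) a horizontal Kronecker block of size $(h-1)\times h$, $h\ge 1$: $A_i=(0\,|\,I_{h-1})$, $B_i=(I_{h-1}\,|\,0)$; (iv) a vertical Kronecker block of size $v\times(v-1)$, $v\ge1$: the transposes of the matrices in (iii) with $h=v$. A $0\times 1$ horizontal block ($h=1$) is a zero column and a $1\times 0$ vertical block ($v=1$) is a zero row. The blocks are unique up to permutation. The numbers $h$ (widths of horizontal blocks) are the horizontal indices, the numbers $v$ (heights of vertical blocks) are the vertical indices. Representations. For a representation $\rho:\mathfrak{g}\to\mathfrak{gl}(V)$ and $x\in V$ put $R_x:\mathfrak{g}\to V$, $R_x(\xi)=\rho(\xi)x$. The algebraic type of the pencil $R_a+\lambda R_b=R_{a+\lambda b}$ is the collection: number of distinct eigenvalues of Jordan blocks, number and sizes of the Jordan blocks for each eigenvalue, horizontal and vertical indices (with multiplicity). The Jordan--Kronecker (JK) invariants of $\rho$ are the algebraic type of $R_{a+\lambda b}$ for a generic pair $(a,b)\in V\times V$ (i.e. for all pairs in some non-empty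 Zariski open subset). The sum of $m$ standard representations of a matrix Lie algebra $\mathfrak{g}\subset\mathfrak{gl}(n)$ is the representation on $n\times m$ matrices given by $\rho(Y)X=YX$, $Y\in\mathfrak{g}$, $X\in\mathrm{Mat}_{n\times m}$. Here $\mathfrak{sl}(n)$ is the Lie algebra of traceless $n\times n$ matrices. (If $m=n=1$, "$n-1$ blocks for each eigenvalue" means that there are no Jordan blocks.) *)

theory Defs
  imports "HOL-Analysis.Analysis" "Jordan_Normal_Form.Jordan_Normal_Form"
begin

(* Jordan_Normal_Form.Matrix and HOL-Analysis share some names; its matrices ('a mat, with
   dimensions in nat, possibly 0) hold Kronecker blocks and matrices of linear maps, while elements
   of Mat_{n x m} and sl(n) are the finite Cartesian products of HOL-Analysis. *)

section \<open>Blocks of the Kronecker canonical form\<close>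

datatype eigenval = Finite_ev complex | Infinite_ev

(* Jordan e k is k x k, Horizontal h is (h-1) x h, Vertical v is v x (v-1). *)
datatype kblock = Jordan eigenval nat | Horizontal nat | Vertical nat

fun block_ok :: "kblock \<Rightarrow> bool" where
  "block_ok (Jordan e k) \<longleftrightarrow> k \<ge> 1"
| "block_ok (Horizontal h) \<longleftrightarrow> h \<ge> 1"
| "block_ok (Vertical v) \<longleftrightarrow> v \<ge> 1"

(* (0 | I) and (I | 0), of size (h-1) x h *)
definition horiz_A :: "nat \<Rightarrow> complex Matrix.mat" where
  "horiz_A h = Matrix.mat (h - 1) h (\<lambda>(i, j). if j = Suc i then 1 else 0)"

definition horiz_B :: "nat \<Rightarrow> complex Matrix.mat" where
  "horiz_B h = Matrix.mat (h - 1) h (\<lambda>(i, j). if j = i then 1 else 0)"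

fun block_A :: "kblock \<Rightarrow> complex Matrix.mat" where
  "block_A (Jordan (Finite_ev l) k) = jordan_block k l"
| "block_A (Jordan Infinite_ev k) = 1\<^sub>m k"
| "block_A (Horizontal h) = horiz_A h"
| "block_A (Vertical v) = transpose_mat (horiz_A v)"

fun block_B :: "kblock \<Rightarrow> complex Matrix.mat" where
  "block_B (Jordan (Finite_ev l) k) = 1\<^sub>m k"
| "block_B (Jordan Infinite_ev k) = jordan_block k 0"
| "block_B (Horizontal h) = horiz_B h"
| "block_B (Vertical v) = transpose_mat (horiz_B v)"

section \<open>Algebraic type of a pencil\<close>

(* jordan_part has one entry for each distinct eigenvalue, namely the multiset of the sizes of its
   Jordan blocks; the eigenvalues themselves are forgotten. *)
record jk_type =
  jordan_part :: "nat multiset multiset"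
  horizontal_indices :: "nat multiset"
  vertical_indices :: "nat multiset"

definition type_of_blocks :: "kblock list \<Rightarrow> jk_type" where
  "type_of_blocks bs =
    \<lparr> jordan_part =
        image_mset (\<lambda>e. mset [k. Jordan e' k \<leftarrow> bs, e' = e]) (mset_set {e. \<exists>k. Jordan e k \<in> set bs}),
      horizontal_indices = mset [h. Horizontal h \<leftarrow> bs],
      vertical_indices = mset [v. Vertical v \<leftarrow> bs] \<rparr>"

(* Vector spaces over the complex numbers are given by an explicit scalar multiplication s,
   as in the locale vector_space. *)

definition ordered_basis ::
  "(complex \<Rightarrow> 'v::ab_group_add \<Rightarrow> 'v) \<Rightarrow> 'v set \<Rightarrow> 'v list \<Rightarrow> bool" where
  "ordered_basis s S us \<longleftrightarrow>
     distinct us \<and> \<not> module.dependent s (set us) \<and> module.span s (set us) = S"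

definition is_matrix_of ::
  "(complex \<Rightarrow> 'v::ab_group_add \<Rightarrow> 'v) \<Rightarrow> 'u list \<Rightarrow> 'v list \<Rightarrow> ('u \<Rightarrow> 'v) \<Rightarrow> complex Matrix.mat \<Rightarrow> bool"
where
  "is_matrix_of s us vs f M \<longleftrightarrow>
     M \<in> carrier_mat (length vs) (length us) \<and>
     (\<forall>j<length us. f (us ! j) = (\<Sum>i<length vs. s (M $$ (i, j)) (vs ! i)))"

(* By Kronecker's theorem exactly one T satisfies this for linear A, B : U -> V
   between finite-dimensional U and V. *)
definition has_algebraic_type ::
  "(complex \<Rightarrow> 'u::ab_group_add \<Rightarrow> 'u) \<Rightarrow> (complex \<Rightarrow> 'v::ab_group_add \<Rightarrow> 'v) \<Rightarrow>
   'u set \<Rightarrow> 'v set \<Rightarrow> ('u \<Rightarrow> 'v) \<Rightarrow> ('u \<Rightarrow> 'v) \<Rightarrow> jk_type \<Rightarrow> bool" where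
  "has_algebraic_type sU sV U V A B T \<longleftrightarrow>
     (\<exists>us vs bs. ordered_basis sU U us \<and> ordered_basis sV V vs \<and>
        (\<forall>b\<in>set bs. block_ok b) \<and>
        is_matrix_of sV us vs A (diag_block_mat (map block_A bs)) \<and>
        is_matrix_of sV us vs B (diag_block_mat (map block_B bs)) \<and>
        type_of_blocks bs = T)"

section \<open>Zariski topology\<close>

inductive_set polynomial_functions ::
  "(complex \<Rightarrow> 'v::ab_group_add \<Rightarrow> 'v) \<Rightarrow> ('v \<Rightarrow> complex) set"
  for s :: "complex \<Rightarrow> 'v::ab_group_add \<Rightarrow> 'v"
where
  const: "(\<lambda>x. c) \<in> polynomial_functions s"
| linear: "Vector_Spaces.linear s (*) f \<Longrightarrow> f \<in> polynomial_functions s"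
| add: "f \<in> polynomial_functions s \<Longrightarrow> g \<in> polynomial_functions s \<Longrightarrow>
    (\<lambda>x. f x + g x) \<in> polynomial_functions s"
| mult: "f \<in> polynomial_functions s \<Longrightarrow> g \<in> polynomial_functions s \<Longrightarrow>
    (\<lambda>x. f x * g x) \<in> polynomial_functions s"

definition zariski_open :: "(complex \<Rightarrow> 'v::ab_group_add \<Rightarrow> 'v) \<Rightarrow> 'v set \<Rightarrow> bool" where
  "zariski_open s W \<longleftrightarrow>
     (\<exists>F \<subseteq> polynomial_functions s. W = - {x. \<forall>f\<in>F. f x = 0})"

section \<open>Jordan--Kronecker invariants of a representation\<close>

(* The Lie algebra is the subspace g of the type 'g, acting on the whole type 'v. *)

definition R_map :: "('g \<Rightarrow> 'v \<Rightarrow> 'v) \<Rightarrow> 'v \<Rightarrow> 'g \<Rightarrow> 'v" where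
  "R_map \<rho> x = (\<lambda>\<xi>. \<rho> \<xi> x)"

definition JK_invariants ::
  "(complex \<Rightarrow> 'g::ab_group_add \<Rightarrow> 'g) \<Rightarrow> (complex \<Rightarrow> 'v::ab_group_add \<Rightarrow> 'v) \<Rightarrow>
   'g set \<Rightarrow> ('g \<Rightarrow> 'v \<Rightarrow> 'v) \<Rightarrow> jk_type \<Rightarrow> bool" where
  "JK_invariants sg sV g \<rho> T \<longleftrightarrow>
     (\<exists>W. zariski_open (module_prod.scale sV sV) W \<and> W \<noteq> {} \<and>
        (\<forall>(a, b)\<in>W. has_algebraic_type sg sV g UNIV (R_map \<rho> a) (R_map \<rho> b) T))"

section \<open>Sums of standard representations of sl(n)\<close>

(* complex^'m^'n is the type of matrices with CARD('n) rows and CARD('m) columns. *)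

definition mscale :: "complex \<Rightarrow> complex^'m^'n \<Rightarrow> complex^'m^'n" where
  "mscale c X = (\<chi> i j. c * X $ i $ j)"

definition sl :: "(complex^'n^'n) set" where
  "sl = {Y. Determinants.trace Y = 0}"

definition std_rep :: "complex^'n^'n \<Rightarrow> complex^'m^'n \<Rightarrow> complex^'m^'n" where
  "std_rep Y X = Y ** X"

interpretation cmat: vector_space "mscale :: complex \<Rightarrow> complex^'m^'n \<Rightarrow> complex^'m^'n"
  by unfold_locales (simp_all add: mscale_def Finite_Cartesian_Product.vec_eq_iff algebra_simps)

interpretation cmat_prod: vector_space_prod
  "mscale :: complex \<Rightarrow> complex^'m^'n \<Rightarrow> complex^'m^'n"
  "mscale :: complex \<Rightarrow> complex^'m^'n \<Rightarrow> complex^'m^'n" ..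

lemma subspace_sl: "cmat.subspace (sl :: (complex^'n^'n) set)"
  by (auto simp: cmat.subspace_def sl_def trace_def mscale_def sum.distrib
      simp flip: sum_distrib_left)

lemma linear_R_map_std_rep:
  "Vector_Spaces.linear mscale mscale (R_map std_rep (X :: complex^'m^'n))"
  by unfold_locales
    (simp_all add: R_map_def std_rep_def mscale_def matrix_matrix_mult_def Finite_Cartesian_Product.vec_eq_iff
      algebra_simps sum.distrib sum_distrib_left)

end

(* A generic pencil a + lambda b of n x m matrices is equivalent under GL(n) x GL(m) to a normal form,
   and the equivalence carries the pencil R_a + lambda R_b on sl(n) to that of the normal form. For
   m different from n there is a single normal form, the shift pencil, and its orbit contains a Zariski
   open set because it is infinitesimally rigid. For m = n the normal form is (diag(mu), 1) with
   distinct mu, available where det b and the discriminant of det(x b - a) do not vanish. At the normal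
   form the canonical blocks are spanned by explicit combinations of matrix units; that these are
   bases follows from spanning and counting. *)

theory Submission
  imports Defs "Subresultants.Subresultant_Gcd" "HOL-Computational_Algebra.Field_as_Ring"
begin

text \<open>On all of gl(n) the answer would be immediate: right multiplication by an n x m pencil
  acts on each row of Y separately, so every block occurs n times. The obstacle is the trace
  condition, which ties rows together. For shift pencils with d = |n - m|, a chain of matrix units
  in row k meets the trace only if it contains E_kk, that is, if its column residue modulo d is that
  of k. All such residue classes but one can be made traceless by subtracting elements of the
  remaining class. There the units form an s x s array, which must lose one dimension. Differences
  of diagonal neighbours give s^2 - 1 = (s - 1)(s + 1) elements: s - 1 chains of length s + 1 if m <
  n, and s + 1 chains of length s - 1 if m > n. This exchange is the source of the corrections by q,
  q + 1 and q + 2 in the multiplicities. For m = n it is the n-dimensional space of diagonal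
  matrices that loses one dimension and becomes the vertical block.\<close>

no_notation Matrix.vec_index (infixl \<open>$\<close> 100)

section \<open>Pencils in block form\<close>

lemma sum_lessThan_add:
  fixes f :: "nat \<Rightarrow> 'a::comm_monoid_add"
  shows "(\<Sum>i<a + b. f i) = (\<Sum>i<a. f i) + (\<Sum>i<b. f (a + i))"
  by (induction b) (simp_all add: add.assoc)

text \<open>The basis conditions are left out, which makes the notion stable under concatenation:
  the lists are assembled from chains, and the basis property is proved once for the complete
  lists.\<close>

definition block_form ::
  "(complex \<Rightarrow> 'v::ab_group_add \<Rightarrow> 'v) \<Rightarrow> ('u \<Rightarrow> 'v) \<Rightarrow> ('u \<Rightarrow> 'v) \<Rightarrow> kblock list \<Rightarrow> 'u list \<Rightarrow> 'v list \<Rightarrow> bool"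
where
  "block_form s A B bs us vs \<longleftrightarrow>
     is_matrix_of s us vs A (diag_block_mat (map block_A bs)) \<and>
     is_matrix_of s us vs B (diag_block_mat (map block_B bs))"

lemma is_matrix_of_append:
  assumes s: "vector_space s"
    and 1: "is_matrix_of s us vs f M" and 2: "is_matrix_of s us' vs' f M'"
  shows "is_matrix_of s (us @ us') (vs @ vs') f
    (four_block_mat M (0\<^sub>m (dim_row M) (dim_col M')) (0\<^sub>m (dim_row M') (dim_col M)) M')"
    (is "is_matrix_of _ _ _ _ ?N")
  unfolding is_matrix_of_def
proof (intro conjI allI impI)
  interpret vector_space s by (rule s)
  have M: "M \<in> carrier_mat (length vs) (length us)" "M' \<in> carrier_mat (length vs') (length us')"
    using 1 2 by (auto simp: is_matrix_of_def)
  then show "?N \<in> carrier_mat (length (vs @ vs')) (length (us @ us'))"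
    by (intro carrier_matI) auto
  fix j assume j: "j < length (us @ us')"
  show "f ((us @ us') ! j) = (\<Sum>i<length (vs @ vs'). s (?N $$ (i, j)) ((vs @ vs') ! i))"
  proof (cases "j < length us")
    case True
    have "f (us ! j) = (\<Sum>i<length vs. s (M $$ (i, j)) (vs ! i))"
      using 1 True by (auto simp: is_matrix_of_def)
    then show ?thesis
      using M True by (simp add: sum_lessThan_add nth_append)
  next
    case False
    with j have "f (us' ! (j - length us)) =
        (\<Sum>i<length vs'. s (M' $$ (i, j - length us)) (vs' ! i))"
      using 2 by (auto simp: is_matrix_of_def)
    then show ?thesis
      using M False j by (simp add: sum_lessThan_add nth_append)
  qed
qed

lemma block_form_Nil: "block_form s A B [] [] []"
  by (simp add: block_form_def is_matrix_of_def)

lemma block_form_append: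
  assumes "vector_space s" "block_form s A B bs us vs" "block_form s A B bs' us' vs'"
  shows "block_form s A B (bs @ bs') (us @ us') (vs @ vs')"
  using assms is_matrix_of_append
  by (auto simp: block_form_def diag_block_mat_append Let_def)

lemma block_form_concat:
  assumes "vector_space s" "\<And>x. x \<in> set L \<Longrightarrow> block_form s A B [b x] (us x) (vs x)"
  shows "block_form s A B (map b L) (concat (map us L)) (concat (map vs L))"
  using assms(2)
proof (induction L)
  case (Cons x L)
  then show ?case
    using block_form_append[OF assms(1), of A B "[b x]" "us x" "vs x"] by simp
qed (simp add: block_form_Nil)

section \<open>Canonical blocks as chains of vectors\<close>

lemma sum_scale_delta:
  assumes "vector_space s"
  shows "(\<Sum>i<(n::nat). s (if i = a then 1 else 0) (v i)) = (if a < n then v a else 0)"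
proof -
  interpret vector_space s by (rule assms)
  have "(\<Sum>i<n. s (if i = a then 1 else 0) (v i)) = (\<Sum>i<n. if i = a then v i else 0)"
    by (intro sum.cong) auto
  then show ?thesis by simp
qed

text \<open>In chain form, A lowers the index by one, B keeps it, and each kills one end of the
  chain. Here h counts the images, so the horizontal index is \<open>Suc h\<close>; h = 0 gives a
  common kernel vector.\<close>

lemma block_form_Horizontal:
  assumes s: "vector_space s"
    and A0: "A (u 0) = 0" and Ah: "B (u h) = 0"
    and A: "\<And>p. p < h \<Longrightarrow> A (u (Suc p)) = v p" and B: "\<And>p. p < h \<Longrightarrow> B (u p) = v p"
  shows "block_form s A B [Horizontal (Suc h)] (map u [0..<Suc h]) (map v [0..<h])"
proof -
  interpret vector_space s by (rule s)
  have *: "(\<Sum>i<h. s (horiz_A (Suc h) $$ (i, j)) (map v [0..<h] ! i)) =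
       (\<Sum>i<h. s (if j = Suc i then 1 else 0) (v i))"
    "(\<Sum>i<h. s (horiz_B (Suc h) $$ (i, j)) (map v [0..<h] ! i)) =
       (\<Sum>i<h. s (if i = j then 1 else 0) (v i))" if "j < Suc h" for j
    using that by (intro sum.cong; auto simp: horiz_A_def horiz_B_def)+
  have "A (map u [0..<Suc h] ! j) = (\<Sum>i<h. s (horiz_A (Suc h) $$ (i, j)) (map v [0..<h] ! i))"
    "B (map u [0..<Suc h] ! j) = (\<Sum>i<h. s (horiz_B (Suc h) $$ (i, j)) (map v [0..<h] ! i))"
    if j: "j < Suc h" for j
  proof -
    show "A (map u [0..<Suc h] ! j) = (\<Sum>i<h. s (horiz_A (Suc h) $$ (i, j)) (map v [0..<h] ! i))"
      unfolding *[OF j]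
    proof (cases j)
      case (Suc p)
      then show "A (map u [0..<Suc h] ! j) = (\<Sum>i<h. s (if j = Suc i then 1 else 0) (v i))"
        using j A[of p] sum_scale_delta[OF s, of p v h] by (simp add: eq_commute del: upt_Suc diag_block_mat.simps)
    qed (simp add: A0 del: upt_Suc diag_block_mat.simps)
    show "B (map u [0..<Suc h] ! j) = (\<Sum>i<h. s (horiz_B (Suc h) $$ (i, j)) (map v [0..<h] ! i))"
      unfolding *[OF j] sum_scale_delta[OF s]
      using j B[of j] Ah by (cases "j = h") (auto simp del: upt_Suc diag_block_mat.simps)
  qed
  then show ?thesis
    by (simp add: block_form_def is_matrix_of_def horiz_A_def horiz_B_def del: upt_Suc diag_block_mat.simps)
qed

text \<open>Now A raises the index by one and nothing is killed. For h = 0 the chain of arguments is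
  empty and \<open>v 0\<close> alone forms a zero row.\<close>

lemma block_form_Vertical:
  assumes s: "vector_space s"
    and A: "\<And>p. p < h \<Longrightarrow> A (u p) = v (Suc p)" and B: "\<And>p. p < h \<Longrightarrow> B (u p) = v p"
  shows "block_form s A B [Vertical (Suc h)] (map u [0..<h]) (map v [0..<Suc h])"
proof -
  have "A (map u [0..<h] ! j) =
      (\<Sum>i<Suc h. s (transpose_mat (horiz_A (Suc h)) $$ (i, j)) (map v [0..<Suc h] ! i))"
    "B (map u [0..<h] ! j) =
      (\<Sum>i<Suc h. s (transpose_mat (horiz_B (Suc h)) $$ (i, j)) (map v [0..<Suc h] ! i))"
    if j: "j < h" for j
  proof -
    have *: "(\<Sum>i<Suc h. s (transpose_mat (horiz_A (Suc h)) $$ (i, j)) (map v [0..<Suc h] ! i)) =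
         (\<Sum>i<Suc h. s (if i = Suc j then 1 else 0) (v i))"
      "(\<Sum>i<Suc h. s (transpose_mat (horiz_B (Suc h)) $$ (i, j)) (map v [0..<Suc h] ! i)) =
         (\<Sum>i<Suc h. s (if i = j then 1 else 0) (v i))"
      using j by (intro sum.cong; auto simp: horiz_A_def horiz_B_def simp del: upt_Suc)+
    show "A (map u [0..<h] ! j) =
        (\<Sum>i<Suc h. s (transpose_mat (horiz_A (Suc h)) $$ (i, j)) (map v [0..<Suc h] ! i))"
      "B (map u [0..<h] ! j) =
        (\<Sum>i<Suc h. s (transpose_mat (horiz_B (Suc h)) $$ (i, j)) (map v [0..<Suc h] ! i))"
      unfolding * sum_scale_delta[OF s] using j A[OF j] B[OF j] by auto
  qed
  then show ?thesis
    by (simp add: block_form_def is_matrix_of_def horiz_A_def horiz_B_def del: upt_Suc sum.lessThan_Suc diag_block_mat.simps)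
qed

lemma block_form_Jordan_1:
  assumes "vector_space s" "A u = s l v" "B u = v"
  shows "block_form s A B [Jordan (Finite_ev l) 1] [u] [v]"
proof -
  interpret vector_space s by (rule assms)
  show ?thesis using assms(2,3) by (simp add: block_form_def is_matrix_of_def jordan_block_def del: diag_block_mat.simps)
qed

lemma has_algebraic_typeI:
  assumes "ordered_basis sU U us" "ordered_basis sV V vs" "\<forall>b\<in>set bs. block_ok b"
    "block_form sV A B bs us vs" "type_of_blocks bs = T"
  shows "has_algebraic_type sU sV U V A B T"
  using assms unfolding has_algebraic_type_def block_form_def by blast

lemma ordered_basis_image:
  assumes s: "vector_space s" "vector_space s'" and f: "Vector_Spaces.linear s s' f" and inj: "inj f"
    and us: "ordered_basis s S us"
  shows "ordered_basis s' (f ` S) (map f us)"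
proof -
  interpret vector_space_pair s s' using s by (simp add: vector_space_pair_def)
  show ?thesis
    using us inj_on_subset[OF inj subset_UNIV] linear_span_image[OF f]
      linear_independent_injective_image[OF f]
    by (simp add: ordered_basis_def distinct_map)
qed

text \<open>Carrying the two bases over by \<phi> and \<psi> leaves the matrices of the pencil
  unchanged.\<close>

lemma has_algebraic_type_transport:
  assumes s: "vector_space sU" "vector_space sV"
    and \<phi>: "Vector_Spaces.linear sU sU \<phi>" "inj \<phi>" "\<phi> ` U = U"
    and \<psi>: "Vector_Spaces.linear sV sV \<psi>" "inj \<psi>" "\<psi> ` V = V"
    and A: "\<And>u. A' (\<phi> u) = \<psi> (A u)" and B: "\<And>u. B' (\<phi> u) = \<psi> (B u)"
    and T: "has_algebraic_type sU sV U V A B T"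
  shows "has_algebraic_type sU sV U V A' B' T"
proof -
  interpret \<psi>: Vector_Spaces.linear sV sV \<psi> by (rule \<psi>)
  have *: "is_matrix_of sV (map \<phi> us) (map \<psi> vs) f' M"
    if "is_matrix_of sV us vs f M" "\<And>u. f' (\<phi> u) = \<psi> (f u)" for us vs f f' M
    using that by (auto simp: is_matrix_of_def \<psi>.sum \<psi>.scale)
  obtain us vs bs where "ordered_basis sU U us" "ordered_basis sV V vs" "\<forall>b\<in>set bs. block_ok b"
    "block_form sV A B bs us vs" "type_of_blocks bs = T"
    using T unfolding has_algebraic_type_def block_form_def by blast
  moreover have "block_form sV A' B' bs (map \<phi> us) (map \<psi> vs)"
    using \<open>block_form sV A B bs us vs\<close> * A B unfolding block_form_def by blast
  ultimately show ?thesis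
    using ordered_basis_image[OF s(1) s(1) \<phi>(1,2), of U us]
      ordered_basis_image[OF s(2) s(2) \<psi>(1,2), of V vs] \<phi>(3) \<psi>(3)
    by (intro has_algebraic_typeI) auto
qed

section \<open>Polynomial functions and rigid pairs\<close>

lemma polynomial_functions_sum:
  "(\<And>i. i \<in> I \<Longrightarrow> f i \<in> polynomial_functions s) \<Longrightarrow> (\<lambda>x. \<Sum>i\<in>I. f i x) \<in> polynomial_functions s"
  by (induction I rule: infinite_finite_induct)
    (auto intro: polynomial_functions.intros)

lemma polynomial_functions_prod:
  "(\<And>i. i \<in> I \<Longrightarrow> f i \<in> polynomial_functions s) \<Longrightarrow> (\<lambda>x. \<Prod>i\<in>I. f i x) \<in> polynomial_functions s"
  by (induction I rule: infinite_finite_induct)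
    (auto intro: polynomial_functions.intros)

lemma polynomial_functions_diff:
  assumes "f \<in> polynomial_functions s" "g \<in> polynomial_functions s"
  shows "(\<lambda>x. f x - g x) \<in> polynomial_functions s"
proof -
  have "(\<lambda>x. f x + (-1) * g x) \<in> polynomial_functions s"
    using assms by (intro polynomial_functions.add polynomial_functions.mult polynomial_functions.const)
  then show ?thesis by simp
qed

lemma polynomial_functions_det:
  fixes M :: "'v::ab_group_add \<Rightarrow> complex^'k::finite^'k"
  assumes "\<And>i j. (\<lambda>x. M x $ i $ j) \<in> polynomial_functions s"
  shows "(\<lambda>x. Determinants.det (M x)) \<in> polynomial_functions s"
  unfolding Determinants.det_def
  by (intro polynomial_functions_sum polynomial_functions_prod polynomial_functions.mult
      polynomial_functions.const assms)

lemma zariski_open_nonzero: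
  "f \<in> polynomial_functions s \<Longrightarrow> zariski_open s {x. f x \<noteq> 0}"
  unfolding zariski_open_def by (intro exI[of _ "{f}"]) auto

abbreviation pscale :: "complex \<Rightarrow> (complex^'m^'n) \<times> (complex^'m^'n) \<Rightarrow> (complex^'m^'n) \<times> (complex^'m^'n)" where
  "pscale \<equiv> module_prod.scale mscale mscale"

lemma vector_space_complex: "vector_space ((*) :: complex \<Rightarrow> complex \<Rightarrow> complex)"
  by unfold_locales (auto simp: algebra_simps)

lemma polynomial_functions_entry:
  "(\<lambda>X. fst X $ i $ j) \<in> polynomial_functions (pscale :: _ \<Rightarrow> (complex^'m^'n) \<times> _ \<Rightarrow> _)"
  "(\<lambda>X. snd X $ i $ j) \<in> polynomial_functions (pscale :: _ \<Rightarrow> (complex^'m^'n) \<times> _ \<Rightarrow> _)"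
proof -
  interpret C: vector_space "(*) :: complex \<Rightarrow> complex \<Rightarrow> complex"
    by (rule vector_space_complex)
  show "(\<lambda>X. fst X $ i $ j) \<in> polynomial_functions (pscale :: _ \<Rightarrow> (complex^'m^'n) \<times> _ \<Rightarrow> _)"
    "(\<lambda>X. snd X $ i $ j) \<in> polynomial_functions (pscale :: _ \<Rightarrow> (complex^'m^'n) \<times> _ \<Rightarrow> _)"
    by (intro polynomial_functions.linear; unfold_locales;
        auto simp: cmat_prod.scale_def mscale_def algebra_simps)+
qed

text \<open>This is D (1 + sum_k (c k / D) G k): a solution by Cramer's rule with its denominator D
  cleared, so that it stays polynomial in the data.\<close>

definition unit_comb ::
  "complex \<Rightarrow> ('k::finite \<Rightarrow> complex) \<Rightarrow> ('k \<Rightarrow> complex^'p^'p) \<Rightarrow> complex^'p^'p" where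
  "unit_comb D c G = (\<chi> i j. D * (if i = j then 1 else 0) + (\<Sum>k\<in>UNIV. c k * G k $ i $ j))"

lemma unit_comb_mult:
  "(unit_comb D c G ** X) $ i $ j = D * X $ i $ j + (\<Sum>k\<in>UNIV. c k * (G k ** X) $ i $ j)"
proof -
  have "(unit_comb D c G ** X) $ i $ j =
      (\<Sum>l\<in>UNIV. D * (if i = l then 1 else 0) * X $ l $ j) + (\<Sum>l\<in>UNIV. \<Sum>k\<in>UNIV. c k * G k $ i $ l * X $ l $ j)"
    by (simp add: unit_comb_def matrix_matrix_mult_def distrib_right sum.distrib sum_distrib_right)
  also have "(\<Sum>l\<in>UNIV. D * (if i = l then 1 else 0) * X $ l $ j) = D * X $ i $ j"
    by (simp add: if_distrib if_distribR cong: if_cong)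
  also have "(\<Sum>l\<in>UNIV. \<Sum>k\<in>UNIV. c k * G k $ i $ l * X $ l $ j) = (\<Sum>k\<in>UNIV. c k * (G k ** X) $ i $ j)"
    by (subst sum.swap) (simp add: matrix_matrix_mult_def sum_distrib_left mult.assoc)
  finally show ?thesis .
qed

lemma mult_unit_comb:
  "(X ** unit_comb D c G) $ i $ j = D * X $ i $ j + (\<Sum>k\<in>UNIV. c k * (X ** G k) $ i $ j)"
proof -
  have "(X ** unit_comb D c G) $ i $ j =
      (\<Sum>l\<in>UNIV. X $ i $ l * (D * (if l = j then 1 else 0))) + (\<Sum>l\<in>UNIV. \<Sum>k\<in>UNIV. c k * (X $ i $ l * G k $ l $ j))"
    by (simp add: unit_comb_def matrix_matrix_mult_def distrib_left sum.distrib sum_distrib_left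
        mult.left_commute)
  also have "(\<Sum>l\<in>UNIV. X $ i $ l * (D * (if l = j then 1 else 0))) = D * X $ i $ j"
    by (simp add: if_distrib if_distribR cong: if_cong)
  also have "(\<Sum>l\<in>UNIV. \<Sum>k\<in>UNIV. c k * (X $ i $ l * G k $ l $ j)) = (\<Sum>k\<in>UNIV. c k * (X ** G k) $ i $ j)"
    by (subst sum.swap) (simp add: matrix_matrix_mult_def sum_distrib_left)
  finally show ?thesis .
qed

lemma unit_comb_1_0: "unit_comb 1 (\<lambda>k. 0) G = Finite_Cartesian_Product.mat 1"
  by (simp add: unit_comb_def Finite_Cartesian_Product.mat_def)

text \<open>Writing \<open>G ** a = A0 ** h\<close> without inverses makes the condition, for a
  given pair, a linear system in (G, h).\<close>

definition equivalent_pairs ::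
  "(complex^'m^'n) \<times> (complex^'m^'n) \<Rightarrow> (complex^'m^'n) \<times> (complex^'m^'n) \<Rightarrow> bool" where
  "equivalent_pairs X X0 \<longleftrightarrow> (\<exists>G h. invertible G \<and> invertible h \<and>
     G ** fst X = fst X0 ** h \<and> G ** snd X = snd X0 ** h)"

text \<open>The hypothesis says that the orbit map of \<open>GL\<^sub>n \<times> GL\<^sub>m\<close> through \<open>(A\<^sub>0, B\<^sub>0)\<close> is a submersion
  at the identity. Linearizing \<open>G a = A\<^sub>0 h\<close> around the identity and solving the resulting square
  system by Cramer's rule gives \<open>G\<close> and \<open>h\<close> as polynomials in \<open>(a, b)\<close>.\<close>

lemma rigid_pair_orbit_dense:
  fixes A0 B0 :: "complex^'m^'n"
  assumes surj: "\<And>E F. \<exists>G h. G ** A0 - A0 ** h = E \<and> G ** B0 - B0 ** h = F"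
  shows "\<exists>W. zariski_open pscale W \<and> W \<noteq> {} \<and> (\<forall>X\<in>W. equivalent_pairs X (A0, B0))"
proof -
  define sel :: "bool \<Rightarrow> (complex^'m^'n) \<times> (complex^'m^'n) \<Rightarrow> complex^'m^'n"
    where "sel t X = (if t then fst X else snd X)" for t X
  define X0 where "X0 = (A0, B0)"
  \<comment> \<open>A linear right inverse of the differential is fixed on units. The index k = (i,
    j, t) runs over the entries of a pair of matrices, with t telling the first from the
    second.\<close>
  have "\<exists>Gh. \<forall>t. fst Gh ** sel t X0 - sel t X0 ** snd Gh =
      (\<chi> i j. if (i, j, t) = k then 1 else 0)" for k
    using surj[of "\<chi> i j. if (i, j, True) = k then 1 else 0" "\<chi> i j. if (i, j, False) = k then 1 else 0"]
    by (auto simp: sel_def X0_def all_bool_eq)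
  then obtain Gh where Gh: "\<And>k t. fst (Gh k) ** sel t X0 - sel t X0 ** snd (Gh k) =
      (\<chi> i j. if (i, j, t) = k then 1 else 0)"
    by metis
  define G where "G k = fst (Gh k)" for k
  define H where "H k = snd (Gh k)" for k
  \<comment> \<open>With G = 1 + sum_k y_k \<open>G k\<close> and h = 1 + sum_k y_k
    \<open>H k\<close>, the equations for equivalence become \<open>M X *v y = r X\<close>, with as
    many unknowns as equations.\<close>
  define M :: "_ \<Rightarrow> complex^('n \<times> 'm \<times> bool)^('n \<times> 'm \<times> bool)" where
    "M X = (\<chi> p k. case p of (i, j, t) \<Rightarrow> (G k ** sel t X - sel t X0 ** H k) $ i $ j)" for X
  define r :: "_ \<Rightarrow> complex^('n \<times> 'm \<times> bool)" where
    "r X = (\<chi> p. case p of (i, j, t) \<Rightarrow> (sel t X0 - sel t X) $ i $ j)" for X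
  define D where "D X = Determinants.det (M X)" for X
  define N where "N X k = Determinants.det (\<chi> i j. if j = k then r X $ i else M X $ i $ j)" for X k
  \<comment> \<open>The first factor makes the system solvable, the other two make the resulting
    matrices invertible.\<close>
  define P where "P X = D X * Determinants.det (unit_comb (D X) (N X) G) *
    Determinants.det (unit_comb (D X) (N X) H)" for X
  note poly = polynomial_functions.const polynomial_functions.add polynomial_functions.mult
    polynomial_functions_sum polynomial_functions_diff polynomial_functions_entry
    polynomial_functions_det
  have sel: "(\<lambda>X. sel t X $ i $ j) \<in> polynomial_functions pscale" for t i j
    unfolding sel_def by (cases t) (simp_all add: polynomial_functions_entry)
  have M_poly: "(\<lambda>X. M X $ p $ k) \<in> polynomial_functions pscale" for p k
    by (cases p) (auto simp: M_def matrix_matrix_mult_def intro!: poly sel)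
  have r_poly: "(\<lambda>X. r X $ p) \<in> polynomial_functions pscale" for p
    by (cases p) (auto simp: r_def intro!: poly sel)
  have D_poly: "D \<in> polynomial_functions pscale"
    unfolding D_def by (intro poly M_poly)
  have N_poly: "(\<lambda>X. N X k) \<in> polynomial_functions pscale" for k
    unfolding N_def
  proof (intro poly)
    fix i j
    show "(\<lambda>x. (\<chi> i j. if j = k then r x $ i else M x $ i $ j) $ i $ j) \<in> polynomial_functions pscale"
      by (cases "j = k") (simp_all add: M_poly r_poly)
  qed
  have "P \<in> polynomial_functions pscale"
    unfolding P_def unit_comb_def
    by (intro poly) (simp_all add: poly D_poly N_poly)
  then have "zariski_open pscale {X. P X \<noteq> 0}"
    by (rule zariski_open_nonzero)
  moreover have "P X0 \<noteq> 0"
  proof -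
    \<comment> \<open>At the base point the images of the chosen preimages are exactly the units,
      and the right-hand side vanishes. So the solution is y = 0, both matrices are 1, and P is
      nonzero there.\<close>
    have "M X0 = Finite_Cartesian_Product.mat 1"
      using Gh by (auto simp: M_def Finite_Cartesian_Product.mat_def G_def H_def Finite_Cartesian_Product.vec_eq_iff)
    then have D: "D X0 = 1" by (simp add: D_def)
    have "N X0 k = 0" for k
    proof -
      have "column k (\<chi> i j. if j = k then r X0 $ i else M X0 $ i $ j) = 0"
        by (simp add: column_def Finite_Cartesian_Product.vec_eq_iff r_def split: prod.splits)
      then show ?thesis unfolding N_def by (rule det_zero_column)
    qed
    then have "N X0 = (\<lambda>k. 0)" by auto
    with D show ?thesis by (simp add: P_def unit_comb_1_0)
  qed
  moreover have "equivalent_pairs X (A0, B0)" if X: "P X \<noteq> 0" for X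
  proof -
    have D: "D X \<noteq> 0" and inv: "invertible (unit_comb (D X) (N X) G)" "invertible (unit_comb (D X) (N X) H)"
      using X by (auto simp: P_def invertible_det_nz)
    have "M X *v (\<chi> k. N X k / D X) = r X"
      using cramer[of "M X" "\<chi> k. N X k / D X" "r X"] D by (simp add: D_def N_def)
    then have *: "(\<Sum>k\<in>UNIV. M X $ p $ k * (N X k / D X)) = r X $ p" for p
      by (cases p) (auto simp: matrix_vector_mult_def Finite_Cartesian_Product.vec_eq_iff)
    have "unit_comb (D X) (N X) G ** sel t X = sel t X0 ** unit_comb (D X) (N X) H" for t
    proof -
      have "(\<Sum>k\<in>UNIV. N X k * (G k ** sel t X) $ i $ j) - (\<Sum>k\<in>UNIV. N X k * (sel t X0 ** H k) $ i $ j)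
          = D X * sel t X0 $ i $ j - D X * sel t X $ i $ j" for i j
      proof -
        have "(\<Sum>k\<in>UNIV. N X k * (G k ** sel t X) $ i $ j) - (\<Sum>k\<in>UNIV. N X k * (sel t X0 ** H k) $ i $ j)
          = D X * (\<Sum>k\<in>UNIV. M X $ (i, j, t) $ k * (N X k / D X))"
          using D by (simp add: M_def sum_distrib_left algebra_simps flip: sum_subtractf)
        also have "\<dots> = D X * r X $ (i, j, t)" by (simp only: *)
        finally show ?thesis by (simp add: r_def algebra_simps)
      qed
      then have "D X * sel t X $ i $ j + (\<Sum>k\<in>UNIV. N X k * (G k ** sel t X) $ i $ j)
          = D X * sel t X0 $ i $ j + (\<Sum>k\<in>UNIV. N X k * (sel t X0 ** H k) $ i $ j)" for i j
        by (simp add: diff_eq_eq)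
      then show ?thesis
        by (simp add: Finite_Cartesian_Product.vec_eq_iff unit_comb_mult mult_unit_comb)
    qed
    from this[of True] this[of False] inv show ?thesis
      unfolding equivalent_pairs_def by (auto simp: sel_def X0_def)
  qed
  ultimately show ?thesis by (intro exI[of _ "{X. P X \<noteq> 0}"]) blast
qed

section \<open>From one orbit to the invariants\<close>

text \<open>If \<open>G ** a = A0 ** h\<close>, then R_a (G^-1 Y G) = G^-1 (R_A0 Y) h, and
  conjugation by G preserves the trace. The normal form may vary with the pair, as the eigenvalues
  do for m = n; only its type has to be constant.\<close>

lemma JK_invariants_of_dense_orbits:
  fixes W :: "((complex^'m^'n) \<times> (complex^'m^'n)) set"
  assumes "zariski_open pscale W" "W \<noteq> {}"
    and orbit: "\<And>X. X \<in> W \<Longrightarrow> \<exists>A0 B0. equivalent_pairs X (A0, B0) \<and>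
      has_algebraic_type mscale mscale sl UNIV (R_map std_rep A0) (R_map std_rep B0) T"
  shows "JK_invariants mscale mscale sl (std_rep :: _ \<Rightarrow> complex^'m^'n \<Rightarrow> _) T"
proof -
  have "has_algebraic_type mscale mscale sl UNIV (R_map std_rep a) (R_map std_rep b) T"
    if ab: "(a, b) \<in> W" for a b
  proof -
    obtain A0 B0 :: "complex^'m^'n" and G h
      where T: "has_algebraic_type mscale mscale sl UNIV (R_map std_rep A0) (R_map std_rep B0) T"
        and inv: "invertible G" "invertible h" and G: "G ** a = A0 ** h" "G ** b = B0 ** h"
      using orbit[OF ab] unfolding equivalent_pairs_def fst_conv snd_conv by blast
    from inv obtain G' h' where G': "G ** G' = Finite_Cartesian_Product.mat 1" "G' ** G = Finite_Cartesian_Product.mat 1"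
      and h': "h ** h' = Finite_Cartesian_Product.mat 1" "h' ** h = Finite_Cartesian_Product.mat 1"
      unfolding invertible_def by blast
    have GG': "G ** (G' ** Y) = Y" "G' ** (G ** Y) = Y" for Y :: "complex^'l^'n"
      by (simp_all add: matrix_mul_assoc G')
    have YG: "Y ** G ** G' = Y" "Y ** G' ** G = Y" for Y :: "complex^'n^'l"
      by (simp_all add: G' flip: matrix_mul_assoc)
    have Yh: "Y ** h ** h' = Y" "Y ** h' ** h = Y" for Y :: "complex^'m^'l"
      by (simp_all add: h' flip: matrix_mul_assoc)
    define \<phi> where "\<phi> Y = G' ** Y ** G" for Y
    define \<psi> where "\<psi> V = G' ** V ** h" for V
    have "Vector_Spaces.linear mscale mscale (\<lambda>Y. P ** Y ** Q)" 
      for P :: "complex^'n^'n" and Q :: "complex^'l^'l"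
      unfolding Vector_Spaces.linear_iff
      using cmat.vector_space_axioms
      by (auto simp: matrix_add_ldistrib mscale_def matrix_matrix_mult_def
          Finite_Cartesian_Product.vec_eq_iff sum.distrib algebra_simps sum_distrib_left sum_distrib_right)
    then have lin: "Vector_Spaces.linear mscale mscale \<phi>" "Vector_Spaces.linear mscale mscale \<psi>"
      unfolding \<phi>_def \<psi>_def by blast+
    have trace: "Determinants.trace (\<phi> Y) = Determinants.trace Y" for Y
      unfolding \<phi>_def by (subst trace_mul_sym) (simp add: matrix_mul_assoc G')
    have "\<phi> (G ** Y ** G') = Y" "G ** \<phi> Y ** G' = Y" for Y
      by (simp_all add: \<phi>_def matrix_mul_assoc G' YG)
    note \<phi> = this
    have "\<psi> (G ** Y ** h') = Y" "G ** \<psi> Y ** h' = Y" for Y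
      by (simp_all add: \<psi>_def matrix_mul_assoc G' Yh)
    note \<psi> = this
    have "inj \<phi>" "inj \<psi>"
      using \<phi>(2) \<psi>(2) by (metis injI)+
    moreover have "\<phi> ` sl = sl"
    proof
      show "\<phi> ` sl \<subseteq> sl" by (auto simp: sl_def trace)
      show "sl \<subseteq> \<phi> ` sl"
        using \<phi>(1) trace unfolding sl_def by (metis (mono_tags, lifting) imageI mem_Collect_eq subsetI)
    qed
    moreover have "\<psi> ` UNIV = UNIV"
      using surjI[of \<psi> "\<lambda>Y. G ** Y ** h'"] \<psi>(1) by blast
    moreover have "R_map std_rep a (\<phi> Y) = \<psi> (R_map std_rep A0 Y)"
      "R_map std_rep b (\<phi> Y) = \<psi> (R_map std_rep B0 Y)" for Y
    proof -
      have "R_map std_rep a (\<phi> Y) = G' ** Y ** (G ** a)" "R_map std_rep b (\<phi> Y) = G' ** Y ** (G ** b)"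
        by (simp_all add: R_map_def std_rep_def \<phi>_def matrix_mul_assoc)
      then show "R_map std_rep a (\<phi> Y) = \<psi> (R_map std_rep A0 Y)"
        "R_map std_rep b (\<phi> Y) = \<psi> (R_map std_rep B0 Y)"
        by (simp_all add: G R_map_def std_rep_def \<psi>_def matrix_mul_assoc)
    qed
    ultimately show ?thesis
      using has_algebraic_type_transport[OF cmat.vector_space_axioms cmat.vector_space_axioms
          lin(1) _ _ lin(2) _ _ _ _ T, where A' = "R_map std_rep a" and B' = "R_map std_rep b"]
      by blast
  qed
  then show ?thesis
    using assms(1,2) unfolding JK_invariants_def by blast
qed

corollary JK_invariants_of_rigid_pair:
  fixes A0 B0 :: "complex^'m^'n"
  assumes "\<And>E F. \<exists>G h. G ** A0 - A0 ** h = E \<and> G ** B0 - B0 ** h = F"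
    and "has_algebraic_type mscale mscale sl UNIV (R_map std_rep A0) (R_map std_rep B0) T"
  shows "JK_invariants mscale mscale sl (std_rep :: _ \<Rightarrow> complex^'m^'n \<Rightarrow> _) T"
  using rigid_pair_orbit_dense[OF assms(1)] JK_invariants_of_dense_orbits assms(2) by metis

section \<open>Matrix units and bases\<close>

text \<open>Integer positions allow translates that leave the array; they give the zero matrix,
  whereas subtraction of natural numbers would be cut off at 0.\<close>

definition emat :: "('n \<Rightarrow> nat) \<Rightarrow> ('m \<Rightarrow> nat) \<Rightarrow> int \<Rightarrow> int \<Rightarrow> complex^'m^'n" where
  "emat e f k l = (\<chi> a b. if int (e a) = k \<and> int (f b) = l then 1 else 0)"

abbreviation numbering :: "('n::finite \<Rightarrow> nat) \<Rightarrow> bool" where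
  "numbering e \<equiv> bij_betw e UNIV {..<CARD('n)}"

lemma ex_numbering: "\<exists>e :: 'n::finite \<Rightarrow> nat. numbering e"
  using ex_bij_betw_finite_nat[OF finite[of "UNIV :: 'n set"]] by (simp add: atLeast0LessThan)

lemma numbering_less: "numbering e \<Longrightarrow> e a < CARD('n)" for a :: "'n::finite"
  by (auto simp: bij_betw_def)

lemma numbering_eq: "numbering e \<Longrightarrow> e a = e b \<longleftrightarrow> a = b"
  by (auto simp: bij_betw_def inj_on_def)

lemma numbering_ex: "numbering e \<Longrightarrow> k < CARD('n) \<Longrightarrow> \<exists>a :: 'n::finite. e a = k"
  unfolding bij_betw_def by (metis imageE lessThan_iff)

definition unit_mat :: "'n \<times> 'm \<Rightarrow> complex^'m::finite^'n::finite" where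
  "unit_mat p = (\<chi> i j. if p = (i, j) then 1 else 0)"

lemma unit_mat_nth: "unit_mat p $ i $ j = (if p = (i, j) then 1 else 0)"
  by (simp add: unit_mat_def)

lemma sum_unit_mat: "(\<Sum>p\<in>UNIV. mscale (c p) (unit_mat p)) $ i $ j = c (i, j)"
proof -
  have "(\<Sum>p\<in>UNIV. mscale (c p) (unit_mat p)) $ i $ j = (\<Sum>p\<in>UNIV. if p = (i, j) then c (i, j) else 0)"
    by (simp add: mscale_def unit_mat_nth if_distrib cong: if_cong)
  then show ?thesis by simp
qed

lemma span_eq_UNIV_if_unit_mat:
  fixes S :: "(complex^'m::finite^'n::finite) set"
  assumes "range unit_mat \<subseteq> cmat.span S"
  shows "cmat.span S = UNIV"
proof -
  have "X = (\<Sum>p\<in>UNIV. mscale (X $ fst p $ snd p) (unit_mat p))" for X :: "complex^'m^'n"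
    by (simp add: Finite_Cartesian_Product.vec_eq_iff sum_unit_mat del: sum_component)
  moreover have "(\<Sum>p\<in>UNIV. mscale (X $ fst p $ snd p) (unit_mat p)) \<in> cmat.span S" for X :: "complex^'m^'n"
    using assms by (intro cmat.span_sum cmat.span_scale) auto
  ultimately have "X \<in> cmat.span S" for X :: "complex^'m^'n" by metis
  then show ?thesis by blast
qed

lemma span_eq_UNIV_if_emat:
  fixes e :: "'n::finite \<Rightarrow> nat" and f :: "'m::finite \<Rightarrow> nat"
  assumes ef: "numbering e" "numbering f"
    and "\<And>k l. 0 \<le> k \<Longrightarrow> k < int CARD('n) \<Longrightarrow> 0 \<le> l \<Longrightarrow> l < int CARD('m) \<Longrightarrow> emat e f k l \<in> cmat.span S"
  shows "cmat.span S = UNIV"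
proof (rule span_eq_UNIV_if_unit_mat, rule subsetI)
  fix x :: "complex^'m^'n" assume "x \<in> range unit_mat"
  then obtain a b where "x = unit_mat (a, b)" by auto
  then have "x = emat e f (int (e a)) (int (f b))"
    by (auto simp: emat_def Finite_Cartesian_Product.vec_eq_iff unit_mat_nth numbering_eq[OF ef(1)] numbering_eq[OF ef(2)])
  then show "x \<in> cmat.span S"
    using assms(3) numbering_less[OF ef(1), of a] numbering_less[OF ef(2), of b] by simp
qed

lemma inj_unit_mat: "inj (unit_mat :: 'n::finite \<times> 'm::finite \<Rightarrow> _)"
proof (rule injI)
  fix p q :: "'n \<times> 'm" assume "unit_mat p = unit_mat q"
  then have "unit_mat p $ fst p $ snd p = unit_mat q $ fst p $ snd p" by simp
  then show "p = q" by (simp add: unit_mat_nth split: if_splits)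
qed

lemma card_range_unit_mat: "card (range (unit_mat :: 'n::finite \<times> 'm::finite \<Rightarrow> _)) = CARD('n) * CARD('m)"
  by (simp add: card_image[OF inj_unit_mat])

interpretation cmat: finite_dimensional_vector_space
  "mscale :: complex \<Rightarrow> complex^'m::finite^'n::finite \<Rightarrow> complex^'m^'n" "range unit_mat"
proof
  show "cmat.independent (range (unit_mat :: 'n \<times> 'm \<Rightarrow> _))"
  proof (rule cmat.independent_if_scalars_zero)
    fix c :: "complex^'m^'n \<Rightarrow> complex" and x :: "complex^'m^'n"
    assume c: "(\<Sum>x\<in>range unit_mat. mscale (c x) x) = 0" and "x \<in> range unit_mat"
    then obtain p where x: "x = unit_mat p" by auto
    have "(\<Sum>p\<in>UNIV. mscale (c (unit_mat p)) (unit_mat p :: complex^'m^'n)) = 0"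
      using c by (simp add: sum.reindex[OF inj_unit_mat])
    then have "(\<Sum>p\<in>UNIV. mscale (c (unit_mat p)) (unit_mat p :: complex^'m^'n)) $ fst p $ snd p = 0"
      by (simp only: zero_index)
    then show "c x = 0" by (simp add: x sum_unit_mat del: sum_component)
  qed simp
  show "cmat.span (range (unit_mat :: 'n \<times> 'm \<Rightarrow> _)) = UNIV"
    by (intro span_eq_UNIV_if_unit_mat cmat.span_superset)
qed simp

section \<open>Bases from spanning and counting\<close>

lemma ordered_basis_UNIV_by_counting:
  fixes us :: "(complex^'m::finite^'n::finite) list"
  assumes "cmat.span (set us) = UNIV" "length us = CARD('n) * CARD('m)"
  shows "ordered_basis mscale UNIV us"
proof -
  have dim: "cmat.dim (UNIV :: (complex^'m^'n) set) = CARD('n) * CARD('m)"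
    using cmat.dim_UNIV card_range_unit_mat by metis
  have "cmat.dim (UNIV :: (complex^'m^'n) set) \<le> card (set us)"
    using assms(1) by (intro cmat.dim_le_card) auto
  then have card: "card (set us) = length us"
    using dim assms(2) card_length[of us] by linarith
  then show ?thesis
    using assms dim cmat.card_le_dim_spanning[of "set us" UNIV]
    by (simp add: ordered_basis_def card_distinct)
qed

text \<open>Adjoining one matrix Z of nonzero trace reduces the claim to the full matrix space.
  Independence is inherited by the sublist, and in the expansion of a traceless matrix the
  coefficient of Z must vanish.\<close>

lemma ordered_basis_sl_by_counting:
  fixes us :: "(complex^'n::finite^'n) list"
  assumes "set us \<subseteq> sl" "Determinants.trace Z \<noteq> 0" "cmat.span (insert Z (set us)) = UNIV"
    "length us + 1 = CARD('n) * CARD('n)"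
  shows "ordered_basis mscale sl us"
proof -
  have *: "ordered_basis mscale UNIV (Z # us)"
    using assms by (intro ordered_basis_UNIV_by_counting) auto
  then have "distinct us" "cmat.independent (set us)"
    using cmat.independent_mono[of "insert Z (set us)"] by (auto simp: ordered_basis_def)
  moreover have "cmat.span (set us) = sl"
  proof
    show span: "cmat.span (set us) \<subseteq> sl"
      using assms(1) subspace_sl by (rule cmat.span_minimal)
    show "sl \<subseteq> cmat.span (set us)"
    proof
      fix Y :: "complex^'n^'n" assume Y: "Y \<in> sl"
      have "Y \<in> cmat.span (insert Z (set us))" using assms(3) by simp
      then obtain c where c: "Y - mscale c Z \<in> cmat.span (set us)"
        by (auto simp: cmat.span_insert)
      with span have "Determinants.trace (Y - mscale c Z) = 0" by (auto simp: sl_def)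
      moreover have "Determinants.trace (mscale c Z) = c * Determinants.trace Z"
        by (simp add: Determinants.trace_def mscale_def sum_distrib_left)
      ultimately have "c = 0"
        using Y assms(2) by (simp add: trace_sub sl_def)
      with c show "Y \<in> cmat.span (set us)"
        by simp
    qed
  qed
  ultimately show ?thesis by (simp add: ordered_basis_def)
qed

section \<open>Shift pencils\<close>

text \<open>In numbered coordinates, t = d and t = 0 give the pair (0 over I, I over 0) if n = m +
  d, while t = -d and t = 0 give (0 | I), (I | 0) if m = n + d. As an n x m pencil this is a sum of
  d Kronecker blocks, one for each residue modulo d.\<close>

definition shift_mat :: "('n \<Rightarrow> nat) \<Rightarrow> ('m \<Rightarrow> nat) \<Rightarrow> int \<Rightarrow> complex^'m^'n" where
  "shift_mat e f t = (\<chi> a b. if int (e a) = int (f b) + t then 1 else 0)"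

lemma numbering_ex_int:
  fixes e :: "'n::finite \<Rightarrow> nat"
  assumes e: "numbering e" and "0 \<le> k" "k < int CARD('n)"
  obtains c where "\<And>x. int (e x) = k \<longleftrightarrow> x = c"
proof -
  obtain c where "e c = nat k"
    using numbering_ex[OF e, of "nat k"] assms(2,3) by (auto simp: nat_less_iff)
  then have "int (e x) = k \<longleftrightarrow> x = c" for x
    using numbering_eq[OF e, of x c] assms(2) by auto
  then show ?thesis by (rule that)
qed

lemma emat_mult_shift:
  fixes e :: "'n::finite \<Rightarrow> nat" and f :: "'m::finite \<Rightarrow> nat"
  assumes e: "numbering e"
  shows "emat e e k l ** shift_mat e f t =
    (if 0 \<le> l \<and> l < int CARD('n) then emat e f k (l - t) else 0)"
proof (cases "0 \<le> l \<and> l < int CARD('n)")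
  case True
  then obtain c where c: "\<And>x. int (e x) = l \<longleftrightarrow> x = c"
    using numbering_ex_int[OF e] by metis
  have "int (e c) = l" using c by simp
  have "(emat e e k l ** shift_mat e f t) $ a $ b = emat e f k (l - t) $ a $ b" for a b
  proof -
    have "(emat e e k l ** shift_mat e f t) $ a $ b =
        (\<Sum>x\<in>UNIV. if x = c then emat e f k (l - t) $ a $ b else 0)"
      unfolding matrix_matrix_mult_def emat_def shift_mat_def vec_lambda_beta c
      using \<open>int (e c) = l\<close> by (intro sum.cong) auto
    then show ?thesis by simp
  qed
  then show ?thesis
    using True by (simp add: Finite_Cartesian_Product.vec_eq_iff)
next
  case False
  then have "int (e c) \<noteq> l" for c
    using numbering_less[OF e, of c] by auto
  then show ?thesis
    using False by (auto simp: emat_def matrix_matrix_mult_def Finite_Cartesian_Product.vec_eq_iff)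
qed

lemma emat_outside:
  fixes e :: "'n::finite \<Rightarrow> nat" and f :: "'m::finite \<Rightarrow> nat"
  assumes "numbering e" "numbering f"
    and "k < 0 \<or> k \<ge> int CARD('n) \<or> l < 0 \<or> l \<ge> int CARD('m)"
  shows "emat e f k l = 0"
proof -
  have "\<not> (int (e a) = k \<and> int (f b) = l)" for a b
    using assms(3) numbering_less[OF assms(1), of a] numbering_less[OF assms(2), of b] by auto
  then show ?thesis
    by (simp add: emat_def Finite_Cartesian_Product.vec_eq_iff)
qed

lemma trace_emat:
  fixes e :: "'n::finite \<Rightarrow> nat"
  assumes e: "numbering e"
  shows "Determinants.trace (emat e e k l) = (if k = l \<and> 0 \<le> k \<and> k < int CARD('n) then 1 else 0)"
proof (cases "k = l \<and> 0 \<le> k \<and> k < int CARD('n)")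
  case True
  then obtain c where c: "\<And>x. int (e x) = l \<longleftrightarrow> x = c"
    using numbering_ex_int[OF e] by metis
  have "Determinants.trace (emat e e k l) = (\<Sum>a\<in>UNIV. if a = c then 1 else 0)"
    unfolding Determinants.trace_def emat_def
    using True by (simp add: c)
  with True show ?thesis by simp
next
  case False
  moreover have "emat e e k l $ a $ a = 0" for a
    using False numbering_less[OF e, of a] by (auto simp: emat_def)
  ultimately show ?thesis by (auto simp: Determinants.trace_def)
qed

section \<open>Infinitesimal rigidity of shift pencils\<close>

lemma sum_telescope_atMost:
  fixes f :: "nat \<Rightarrow> 'a::ab_group_add"
  shows "(\<Sum>p\<le>m. f p) - (\<Sum>p\<le>m. f (Suc p)) = f 0 - f (Suc m)"
  by (induction m) (simp_all add: algebra_simps)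

text \<open>On a diagonal that enters the square through its top edge (\<open>k \<le> l\<close>) the recurrence is solved
  downwards, on the other ones it is solved upwards from the bottom edge.\<close>

lemma diagonal_recurrence:
  fixes C :: "int \<Rightarrow> int \<Rightarrow> complex" and m d :: nat
  assumes d: "d > 0"
  obtains \<eta> where "\<And>k l. \<not> (0 \<le> k \<and> k < int m) \<Longrightarrow> \<eta> k l = 0"
    and "\<And>k l. 0 \<le> k \<Longrightarrow> k < int (m + d) \<Longrightarrow> int d \<le> l \<Longrightarrow> l < int m \<Longrightarrow>
      \<eta> k l - \<eta> (k - int d) (l - int d) = C k l"
proof
  \<comment> \<open>C is cut off to the strip where the equation is required. Then m + 1 steps of
    length d along a diagonal leave the strip, so sums with m + 1 terms suffice. \<open>U\<close> is
    the solution that vanishes above the square, \<open>V\<close> the one that vanishes below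
    it.\<close>
  define c where "c k l = (if 0 \<le> k \<and> k < int (m + d) \<and> int d \<le> l \<and> l < int m then C k l else 0)" for k l
  define U where "U k l = (\<Sum>p\<le>m. c (k - int p * int d) (l - int p * int d))" for k l
  define V where "V k l = - (\<Sum>p\<le>m. c (k + int (Suc p) * int d) (l + int (Suc p) * int d))" for k l
  define \<eta> where "\<eta> k l = (if 0 \<le> k \<and> k < int m then if k \<le> l then U k l else V k l else 0)" for k l
  have m_less: "int m < int (Suc m) * int d"
    using d by (metis lessI less_le_trans mult.right_neutral mult_le_mono2 of_nat_less_iff of_nat_mult Suc_leI One_nat_def)
  have U: "U k l - U (k - int d) (l - int d) = c k l" if "l < int m" for k l
  proof -
    have "U (k - int d) (l - int d) = (\<Sum>p\<le>m. c (k - int (Suc p) * int d) (l - int (Suc p) * int d))"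
      unfolding U_def by (intro sum.cong) (auto simp: algebra_simps)
    then have "U k l - U (k - int d) (l - int d) = c k l - c (k - int (Suc m) * int d) (l - int (Suc m) * int d)"
      unfolding U_def using sum_telescope_atMost[of "\<lambda>p. c (k - int p * int d) (l - int p * int d)" m] by simp
    also have "c (k - int (Suc m) * int d) (l - int (Suc m) * int d) = 0"
      using that m_less by (simp add: c_def)
    finally show ?thesis by simp
  qed
  have V: "V k l - V (k - int d) (l - int d) = c k l" if "0 \<le> l" for k l
  proof -
    have "V (k - int d) (l - int d) = - (\<Sum>p\<le>m. c (k + int p * int d) (l + int p * int d))"
      unfolding V_def by (intro arg_cong[of _ _ uminus] sum.cong) (auto simp: algebra_simps)
    then have "V k l - V (k - int d) (l - int d) = c k l - c (k + int (Suc m) * int d) (l + int (Suc m) * int d)"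
      unfolding V_def using sum_telescope_atMost[of "\<lambda>p. c (k + int p * int d) (l + int p * int d)" m] by simp
    also have "c (k + int (Suc m) * int d) (l + int (Suc m) * int d) = 0"
      using that m_less by (simp add: c_def)
    finally show ?thesis by simp
  qed
  have U0: "U k l = 0" if "k < 0" for k l
  proof -
    have "k - int p * int d < 0" for p using that by (smt (verit) of_nat_0_le_iff mult_nonneg_nonneg)
    then have "c (k - int p * int d) (l - int p * int d) = 0" for p
      unfolding c_def by (metis not_le)
    then show ?thesis unfolding U_def by simp
  qed
  have V0: "V k l = 0" if "k \<ge> int m" for k l
  proof -
    have "int (m + d) \<le> k + int (Suc p) * int d" for p
    proof -
      have "0 \<le> int p * int d" by simp
      then show ?thesis using that unfolding of_nat_Suc of_nat_add distrib_right by linarith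
    qed
    then have "c (k + int (Suc p) * int d) (l + int (Suc p) * int d) = 0" for p 
      unfolding c_def by (metis not_le)
    then show ?thesis unfolding V_def by simp
  qed
  show "\<eta> k l = 0" if "\<not> (0 \<le> k \<and> k < int m)" for k l
    using that by (auto simp: \<eta>_def)
  show "\<eta> k l - \<eta> (k - int d) (l - int d) = C k l"
    if kl: "0 \<le> k" "k < int (m + d)" "int d \<le> l" "l < int m" for k l
  proof -
    have c: "c k l = C k l" using kl by (simp add: c_def)
    \<comment> \<open>Both positions lie on the same diagonal, hence on the same side of the case
      split. If one of the two rows lies outside the square, the chosen solution is zero there, in
      agreement with the cut-off in \<eta>.\<close>
    show ?thesis
    proof (cases "k \<le> l")
      case True
      then have "\<eta> k l = U k l" "\<eta> (k - int d) (l - int d) = U (k - int d) (l - int d)"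
        using kl U0[of "k - int d"] by (auto simp: \<eta>_def)
      then show ?thesis using U kl c by simp
    next
      case False
      then have "\<eta> k l = V k l" "\<eta> (k - int d) (l - int d) = V (k - int d) (l - int d)"
        using kl V0[of k] by (auto simp: \<eta>_def)
      then show ?thesis using V kl c by simp
    qed
  qed
qed

lemma sum_numbering_delta:
  fixes e :: "'n::finite \<Rightarrow> nat" and g :: "int \<Rightarrow> complex"
  assumes e: "numbering e"
  shows "(\<Sum>c\<in>UNIV. g (int (e c)) * (if int (e c) = k then 1 else 0)) =
    (if 0 \<le> k \<and> k < int CARD('n) then g k else 0)"
proof (cases "0 \<le> k \<and> k < int CARD('n)")
  case True
  then obtain c where c: "\<And>x. int (e x) = k \<longleftrightarrow> x = c"
    using numbering_ex_int[OF e] by metis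
  then have "int (e c) = k" by simp
  moreover have "(\<Sum>c\<in>UNIV. g (int (e c)) * (if int (e c) = k then 1 else 0)) = g (int (e c))"
    unfolding c by (simp add: mult_delta_right)
  ultimately show ?thesis using True by simp
next
  case False
  then have "int (e c) \<noteq> k" for c
    using numbering_less[OF e, of c] by auto
  with False show ?thesis by auto
qed

text \<open>In coordinates the equations read G(k, l + d) - h(k - d, l) = E(k, l) and G(k, l) - h(k,
  l) = F(k, l) for 0 \<le> l < m. Given h, they prescribe columns l \<ge> d and columns l < m of G,
  respectively. On the overlap d \<le> l < m the two prescriptions agree exactly if h satisfies a
  recurrence along diagonals, with right-hand side E(k, l - d) - F(k, l).\<close>

lemma shift_pair_rigid:
  fixes e :: "'n::finite \<Rightarrow> nat" and f :: "'m::finite \<Rightarrow> nat" and E F :: "complex^'m^'n"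
  assumes e: "numbering e" and f: "numbering f" and n: "CARD('n) = CARD('m) + d" and d: "d > 0"
  shows "\<exists>G h. G ** shift_mat e f (int d) - shift_mat e f (int d) ** h = E \<and>
    G ** shift_mat e f 0 - shift_mat e f 0 ** h = F"
proof -
  let ?m = "int CARD('m)"
  define E' where "E' k l = E $ (inv_into UNIV e (nat k)) $ (inv_into UNIV f (nat l))" for k l :: int
  define F' where "F' k l = F $ (inv_into UNIV e (nat k)) $ (inv_into UNIV f (nat l))" for k l :: int
  have inj: "inj e" "inj f" using e f by (simp_all add: bij_betw_def)
  have E': "E' (int (e a)) (int (f b)) = E $ a $ b" "F' (int (e a)) (int (f b)) = F $ a $ b" for a b
    using inj by (simp_all add: E'_def F'_def)
  obtain \<eta> where \<eta>0: "\<And>k l. \<not> (0 \<le> k \<and> k < ?m) \<Longrightarrow> \<eta> k l = 0"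
    and \<eta>: "\<And>k l. 0 \<le> k \<Longrightarrow> k < int (CARD('m) + d) \<Longrightarrow> int d \<le> l \<Longrightarrow> l < ?m \<Longrightarrow>
      \<eta> k l - \<eta> (k - int d) (l - int d) = E' k (l - int d) - F' k l"
    using diagonal_recurrence[OF d, of "CARD('m)" "\<lambda>k l. E' k (l - int d) - F' k l"] by metis
  \<comment> \<open>On the overlap either formula would do, because \<eta> solves the
    recurrence.\<close>
  define \<gamma> where "\<gamma> k l = (if l < ?m then F' k l + \<eta> k l else E' k (l - int d) + \<eta> (k - int d) (l - int d))" for k l
  define G :: "complex^'n^'n" where "G = (\<chi> a c. \<gamma> (int (e a)) (int (e c)))"
  define h :: "complex^'m^'m" where "h = (\<chi> c b. \<eta> (int (f c)) (int (f b)))"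
  have G: "(G ** shift_mat e f t) $ a $ b = \<gamma> (int (e a)) (int (f b) + t)"
    if "0 \<le> t" "t \<le> int d" for t a b
    using sum_numbering_delta[OF e, of "\<lambda>k. \<gamma> (int (e a)) k" "int (f b) + t"] that numbering_less[OF f, of b] n
    by (simp add: G_def shift_mat_def matrix_matrix_mult_def)
  have h: "(shift_mat e f t ** h) $ a $ b = \<eta> (int (e a) - t) (int (f b))" for t a b
  proof -
    have "(shift_mat e f t ** h) $ a $ b =
       (\<Sum>c\<in>UNIV. \<eta> (int (f c)) (int (f b)) * (if int (f c) = int (e a) - t then 1 else 0))"
      by (auto simp: h_def shift_mat_def matrix_matrix_mult_def intro!: sum.cong)
    also have "\<dots> = \<eta> (int (e a) - t) (int (f b))"
      unfolding sum_numbering_delta[OF f, of "\<lambda>k. \<eta> k (int (f b))"] using \<eta>0 by auto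
    finally show ?thesis .
  qed
  have "\<gamma> (int (e a)) (int (f b) + int d) = E $ a $ b + \<eta> (int (e a) - int d) (int (f b))" for a b
    using \<eta>[of "int (e a)" "int (f b) + int d"] numbering_less[OF e, of a] n E'(1)[of a b]
    by (auto simp: \<gamma>_def algebra_simps)
  moreover have "\<gamma> (int (e a)) (int (f b)) = F $ a $ b + \<eta> (int (e a)) (int (f b))" for a b
    using numbering_less[OF f, of b] by (simp add: \<gamma>_def E')
  ultimately show ?thesis
    by (intro exI[of _ G] exI[of _ h]) (simp add: Finite_Cartesian_Product.vec_eq_iff G h)
qed

lemma transpose_shift_mat:
  "Finite_Cartesian_Product.transpose (shift_mat e f t) = shift_mat f e (- t)"
  by (auto simp: Finite_Cartesian_Product.transpose_def shift_mat_def Finite_Cartesian_Product.vec_eq_iff)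

lemma matrix_transpose_diff:
  fixes X Y :: "'a::ab_group_add^'m^'n"
  shows "Finite_Cartesian_Product.transpose (X - Y) = Finite_Cartesian_Product.transpose X - Finite_Cartesian_Product.transpose Y"
  by (simp add: Finite_Cartesian_Product.transpose_def Finite_Cartesian_Product.vec_eq_iff)

text \<open>Transposition exchanges the roles of G and h, reverses the shift and changes the sign of
  the difference, which is why the previous result is applied to -E and -F.\<close>

lemma shift_pair_rigid_transposed:
  fixes e :: "'n::finite \<Rightarrow> nat" and f :: "'m::finite \<Rightarrow> nat" and E F :: "complex^'m^'n"
  assumes e: "numbering e" and f: "numbering f" and n: "CARD('m) = CARD('n) + d" and d: "d > 0"
  shows "\<exists>G h. G ** shift_mat e f (- int d) - shift_mat e f (- int d) ** h = E \<and>
    G ** shift_mat e f 0 - shift_mat e f 0 ** h = F"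
proof -
  let ?T = Finite_Cartesian_Product.transpose
  obtain G h where "G ** shift_mat f e (int d) - shift_mat f e (int d) ** h = ?T (- E)"
    "G ** shift_mat f e 0 - shift_mat f e 0 ** h = ?T (- F)"
    using shift_pair_rigid[OF f e n d] by metis
  then have "?T (G ** shift_mat f e (int d) - shift_mat f e (int d) ** h) = - E"
    "?T (G ** shift_mat f e 0 - shift_mat f e 0 ** h) = - F"
    by simp_all
  then have "?T h ** shift_mat e f (- int d) - shift_mat e f (- int d) ** ?T G = E"
    "?T h ** shift_mat e f 0 - shift_mat e f 0 ** ?T G = F"
    by (simp_all add: matrix_transpose_diff matrix_transpose_mul transpose_shift_mat)
      (metis minus_diff_eq minus_equation_iff)+
  then show ?thesis by blast
qed

section \<open>Families of chains\<close>

definition chains :: "('x \<Rightarrow> nat \<Rightarrow> 'v) \<Rightarrow> 'x list \<Rightarrow> nat \<Rightarrow> 'v list" where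
  "chains u L h = concat (map (\<lambda>x. map (u x) [0..<h]) L)"

lemma set_chains: "set (chains u L h) = {u x p | x p. x \<in> set L \<and> p < h}"
  by (auto simp: chains_def) blast

lemma length_chains: "length (chains u L h) = length L * h"
  by (induction L) (simp_all add: chains_def)

lemma block_form_Horizontal_chains:
  assumes "vector_space s"
    and "\<And>x. x \<in> set L \<Longrightarrow> A (u x 0) = 0" "\<And>x. x \<in> set L \<Longrightarrow> B (u x h) = 0"
    and "\<And>x p. x \<in> set L \<Longrightarrow> p < h \<Longrightarrow> A (u x (Suc p)) = v x p"
    and "\<And>x p. x \<in> set L \<Longrightarrow> p < h \<Longrightarrow> B (u x p) = v x p"
  shows "block_form s A B (map Horizontal (replicate (length L) (Suc h))) (chains u L (Suc h)) (chains v L h)"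
proof -
  have "block_form s A B (map (\<lambda>x. Horizontal (Suc h)) L)
      (concat (map (\<lambda>x. map (u x) [0..<Suc h]) L)) (concat (map (\<lambda>x. map (v x) [0..<h]) L))"
    using assms by (intro block_form_concat block_form_Horizontal)
  then show ?thesis
    by (simp add: chains_def map_replicate_const del: upt_Suc)
qed

lemma block_form_Vertical_chains:
  assumes "vector_space s"
    and "\<And>x p. x \<in> set L \<Longrightarrow> p < h \<Longrightarrow> A (u x p) = v x (Suc p)"
    and "\<And>x p. x \<in> set L \<Longrightarrow> p < h \<Longrightarrow> B (u x p) = v x p"
  shows "block_form s A B (map Vertical (replicate (length L) (Suc h))) (chains u L h) (chains v L (Suc h))"
proof -
  have "block_form s A B (map (\<lambda>x. Vertical (Suc h)) L)
      (concat (map (\<lambda>x. map (u x) [0..<h]) L)) (concat (map (\<lambda>x. map (v x) [0..<Suc h]) L))"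
    using assms by (intro block_form_concat block_form_Vertical)
  then show ?thesis
    by (simp add: chains_def map_replicate_const del: upt_Suc)
qed

lemma type_of_blocks_Horizontal:
  "type_of_blocks (map Horizontal hs) =
    \<lparr>jordan_part = {#}, horizontal_indices = mset hs, vertical_indices = {#}\<rparr>"
proof -
  have "{e. \<exists>k. Jordan e k \<in> set (map Horizontal hs)} = {}" by auto
  moreover have "[h. Horizontal h \<leftarrow> map Horizontal hs] = hs" "[h. Vertical h \<leftarrow> map Horizontal hs] = []"
    by (induction hs) auto
  ultimately show ?thesis by (simp add: type_of_blocks_def)
qed

lemma type_of_blocks_Vertical:
  "type_of_blocks (map Vertical hs) =
    \<lparr>jordan_part = {#}, horizontal_indices = {#}, vertical_indices = mset hs\<rparr>"
proof -
  have "{e. \<exists>k. Jordan e k \<in> set (map Vertical hs)} = {}" by auto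
  moreover have "[h. Horizontal h \<leftarrow> map Vertical hs] = []" "[h. Vertical h \<leftarrow> map Vertical hs] = hs"
    by (induction hs) auto
  ultimately show ?thesis by (simp add: type_of_blocks_def)
qed

text \<open>A diagonal that meets one of the zero edges b = -1 and b = Q + 1 while a stays in the
  range 0..q can be summed up from that edge. The diagonals missed are those with 0 \<le> b - a
  \<le> Q - q: none for Q = q - 1 (used for the target space) and just the main one for Q = q (used
  for sl(n)).\<close>

lemma (in vector_space) diagonal_span:
  fixes F :: "int \<Rightarrow> int \<Rightarrow> 'b" and q Q :: int
  assumes step: "\<And>a b. 0 \<le> a \<Longrightarrow> a < q \<Longrightarrow> -1 \<le> b \<Longrightarrow> b \<le> Q \<Longrightarrow> F a b - F (a + 1) (b + 1) \<in> span S"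
    and bot: "\<And>a. F a (-1) = 0" and top: "\<And>a. F a (Q + 1) = 0"
    and ab: "0 \<le> a" "a \<le> q" "0 \<le> b" "b \<le> Q"
    and off: "a > b \<or> b - a > Q - q"
  shows "F a b \<in> span S"
  using off
proof
  assume "a > b"
  \<comment> \<open>Here c = a - b numbers the diagonal, and the induction starts from the zero at
    (c - 1, -1).\<close>
  have "F (int j + c) (int j) \<in> span S" if "c > 0" "int j + c \<le> q" "int j \<le> Q" for j c
    using that
  proof (induction j)
    case 0
    then show ?case
      using step[of "c - 1" "-1"] bot[of "c - 1"] span_neg[of "- F c 0"] by simp
  next
    case (Suc j)
    then have "F (int j + c) (int j) - F (int (Suc j) + c) (int (Suc j)) \<in> span S"
      using step[of "int j + c" "int j"] by (simp add: algebra_simps)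
    with Suc show ?case
      using span_diff[of "F (int j + c) (int j)" S "F (int j + c) (int j) - F (int (Suc j) + c) (int (Suc j))"] by simp
  qed
  from this[of "a - b" "nat b"] show ?thesis using \<open>a > b\<close> ab by simp
next
  assume "b - a > Q - q"
  \<comment> \<open>Here c = b - a, and the induction runs backwards from the zero in column Q + 1,
    where the first index is Q + 1 - c \<le> q.\<close>
  have "F (Q + 1 - int j - c) (Q + 1 - int j) \<in> span S"
    if "c > Q - q" "0 \<le> Q + 1 - int j - c" "0 \<le> Q + 1 - int j" for j c
    using that
  proof (induction j)
    case 0
    then show ?case using top span_zero by simp
  next
    case (Suc j)
    let ?x = "F (Q + 1 - int (Suc j) - c) (Q + 1 - int (Suc j))" and ?y = "F (Q + 1 - int j - c) (Q + 1 - int j)"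
    have "?x - ?y \<in> span S"
      using step[of "Q + 1 - int (Suc j) - c" "Q + 1 - int (Suc j)"] Suc.prems by (simp add: algebra_simps)
    moreover have "?y \<in> span S" using Suc by simp
    ultimately show ?case using span_add[of "?x - ?y" S ?y] by simp
  qed
  from this[of "b - a" "nat (Q + 1 - b)"] show ?thesis using \<open>b - a > Q - q\<close> ab by simp
qed

text \<open>The main diagonal meets no zero edge when Q = q; one known element on it replaces the
  missing zero.\<close>

lemma (in vector_space) diagonal_span_insert:
  fixes F :: "int \<Rightarrow> int \<Rightarrow> 'b"
  assumes step: "\<And>a. 0 \<le> a \<Longrightarrow> a < q \<Longrightarrow> F a a - F (a + 1) (a + 1) \<in> span S"
    and a: "0 \<le> a" "a \<le> q" and F0: "F 0 0 \<in> span S"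
  shows "F a a \<in> span S"
proof -
  have "F (int j) (int j) \<in> span S" if "int j \<le> q" for j
    using that
  proof (induction j)
    case (Suc j)
    then show ?case
      using step[of "int j"] span_diff[of "F (int j) (int j)" S "F (int j) (int j) - F (int j + 1) (int j + 1)"]
      by (simp add: algebra_simps)
  qed (simp add: F0)
  from this[of "nat a"] show ?thesis using a by simp
qed

text \<open>The class consists of the numbers i + a d with a < h; the two bounds say that h is the
  first a for which this number is at least n.\<close>

lemma card_residue_class:
  fixes n d h i :: nat
  assumes "i < d" "n \<le> i + h * d" "i + h * d < n + d"
  shows "card {k. k < n \<and> k mod d = i} = h"
proof -
  have "{k. k < n \<and> k mod d = i} = (\<lambda>a. i + a * d) ` {..<h}"
  proof (intro Set.set_eqI iffI)
    fix k assume "k \<in> {k. k < n \<and> k mod d = i}"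
    then have k: "k < n" "k mod d = i" by auto
    have kk: "k = i + k div d * d" using k(2) by (metis add.commute div_mult_mod_eq)
    have "k div d < h"
    proof (rule ccontr)
      assume "\<not> ?thesis"
      then have "h * d \<le> k div d * d" by (intro mult_le_mono1) simp
      with kk k(1) assms show False by linarith
    qed
    with kk show "k \<in> (\<lambda>a. i + a * d) ` {..<h}" by blast
  next
    fix k assume "k \<in> (\<lambda>a. i + a * d) ` {..<h}"
    then obtain a where a: "k = i + a * d" "a < h" by auto
    then have "Suc a * d \<le> h * d" by (intro mult_le_mono1) simp
    then have "k < n" using a assms by simp
    moreover have "k mod d = i" unfolding a(1) using assms(1) by simp
    ultimately show "k \<in> {k. k < n \<and> k mod d = i}" by simp
  qed
  moreover have "inj_on (\<lambda>a. i + a * d) {..<h}"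
    using assms(1) by (intro inj_onI) (metis add_left_cancel mult_right_cancel not_less_zero)
  ultimately show ?thesis by (simp add: card_image)
qed

section \<open>Fewer copies than the dimension\<close>

lemma mem_chains: "x \<in> set L \<Longrightarrow> p < h \<Longrightarrow> u x p \<in> set (chains u L h)"
  unfolding set_chains by blast

lemma R_map_diff:
  "R_map std_rep X (Y - Z) = R_map std_rep X Y - R_map std_rep X Z"
  by (simp add: R_map_def std_rep_def matrix_matrix_mult_def Finite_Cartesian_Product.vec_eq_iff
      left_diff_distrib sum_subtractf)

lemma R_map_zero: "R_map std_rep X 0 = 0"
  by (simp add: R_map_def std_rep_def)

text \<open>For \<open>gl(n)\<close> the matrix units \<open>E\<^sub>k\<^sub>,\<^sub>i, E\<^sub>k\<^sub>,\<^sub>i\<^sub>+\<^sub>d, \<dots>\<close> form one chain for each row \<open>k\<close> and each residue \<open>i\<close>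
  modulo \<open>d\<close>. To make the chains with \<open>k \<equiv> i\<close> traceless, a translate along the diagonal that lies in one
  fixed reference class is subtracted (\<open>coupled\<close>). In the reference class itself all chains are
  replaced by differences of diagonal neighbours (\<open>u'\<close> below); this changes their number by one and
  their length in the opposite direction. Matrix units with an index out of range are zero, which
  makes the boundary chains come out right.\<close>

definition coupled :: "int \<Rightarrow> (int \<Rightarrow> int \<Rightarrow> int) \<Rightarrow> (int \<Rightarrow> int \<Rightarrow> 'a::ab_group_add) \<Rightarrow> int \<Rightarrow> int \<Rightarrow> int \<Rightarrow> 'a" where
  "coupled D t X k i l = X k l - (if k mod D = i then X (k + t k i) (l + t k i) else 0)"

text \<open>The reference class is \<open>d - 1\<close>: its \<open>q + 1\<close> chains of width \<open>q + 1\<close> become \<open>q\<close> chains of width \<open>q + 2\<close>.\<close>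

lemma has_algebraic_type_horizontal:
  fixes e :: "'n::finite \<Rightarrow> nat" and f :: "'m::finite \<Rightarrow> nat" and q r d :: nat
  assumes e: "numbering e" and f: "numbering f"
    and n: "CARD('n) = CARD('m) + d" and m: "CARD('m) = q * d + r" and r: "r < d"
  shows "has_algebraic_type mscale mscale sl UNIV
    (R_map std_rep (shift_mat e f (int d))) (R_map std_rep (shift_mat e f 0))
    \<lparr>jordan_part = {#}, horizontal_indices = replicate_mset (CARD('n) * (d - r) - (q + 1)) (q + 1) +
       replicate_mset (CARD('n) * r + q) (q + 2), vertical_indices = {#}\<rparr>"
proof -
  let ?A = "R_map std_rep (shift_mat e f (int d))" and ?B = "R_map std_rep (shift_mat e f 0)"
  let ?n = "CARD('n)" and ?m = "CARD('m)"
  define D where "D = int d"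
  define Eu where "Eu = emat e e"
  define Ev where "Ev = emat e f"
  have nn: "?n = Suc q * d + r" using n m by simp
  have int_n: "int ?n = (int q + 1) * D + int r" unfolding nn by (simp add: D_def algebra_simps)
  have int_m: "int ?m = int q * D + int r" unfolding m by (simp add: D_def)
  have D: "D > 0" "int r < D" using r by (auto simp: D_def)
  have Eu0: "Eu k l = 0" if "k < 0 \<or> k \<ge> int ?n \<or> l < 0 \<or> l \<ge> int ?n" for k l
    using emat_outside[OF e e that] by (simp add: Eu_def)
  have Ev0: "Ev k l = 0" if "k < 0 \<or> k \<ge> int ?n \<or> l < 0 \<or> l \<ge> int ?m" for k l
    using emat_outside[OF e f that] by (simp add: Ev_def)
  have A: "?A (Eu k l) = Ev k (l - D)" for k l
    using Ev0[of k "l - D"] n by (auto simp: R_map_def std_rep_def Eu_def Ev_def emat_mult_shift[OF e] D_def)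
  have B: "?B (Eu k l) = Ev k l" for k l
    using Ev0[of k l] n by (auto simp: R_map_def std_rep_def Eu_def Ev_def emat_mult_shift[OF e])
  have trace: "Determinants.trace (Eu k l) = (if k = l \<and> 0 \<le> k \<and> k < int ?n then 1 else 0)" for k l
    by (simp add: Eu_def trace_emat[OF e])

  \<comment> \<open>Both values are congruent to -1 - i modulo D, so they move class i to the
    reference class D - 1: forward if the row stays inside the matrix, otherwise backward.\<close>
  define t where "t k i = (if k + (D - 1 - i) < int ?n then D - 1 - i else - 1 - i)" for k i
  define u where "u x p = coupled D t Eu (int (fst x)) (int (snd x)) (int (snd x) + int p * D)" for x :: "nat \<times> nat" and p :: nat
  define v where "v x p = coupled D t Ev (int (fst x)) (int (snd x)) (int (snd x) + int p * D)" for x :: "nat \<times> nat" and p :: nat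
  \<comment> \<open>The reference class in its own coordinates. \<open>Fu\<close> is supported on a
    square array of side q + 1, while \<open>Fv\<close> has only the columns 0, ..., q - 1.\<close>
  define Fu where "Fu a b = Eu (D - 1 + a * D) (D - 1 + b * D)" for a b
  define Fv where "Fv a b = Ev (D - 1 + a * D) (D - 1 + b * D)" for a b
  \<comment> \<open>The shift of p by one lets every chain run from edge to edge:
    \<open>u' a 0\<close> is - \<open>Fu\<close> (a + 1) 0 and \<open>u' a (q + 1)\<close> is
    \<open>Fu\<close> a q, the other term being zero.\<close>
  define u' where "u' a p = Fu (int a) (int p - 1) - Fu (int a + 1) (int p)" for a p :: nat
  define v' where "v' a p = Fv (int a) (int p - 1) - Fv (int a + 1) (int p)" for a p :: nat

  define L1 where "L1 = List.product [0..<?n] [0..<r]"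
  \<comment> \<open>For the removed labels the translation is 0, so the coupled elements would
    vanish; the chains of \<open>u'\<close> take their place.\<close>
  define L2 where "L2 = filter (\<lambda>(k, i). \<not> (i = d - 1 \<and> k mod d = d - 1)) (List.product [0..<?n] [r..<d])"
  have L1: "x \<in> set L1 \<longleftrightarrow> fst x < ?n \<and> snd x < r" for x
    by (cases x) (auto simp: L1_def)
  have L2: "x \<in> set L2 \<longleftrightarrow> fst x < ?n \<and> r \<le> snd x \<and> snd x < d \<and> \<not> (snd x = d - 1 \<and> fst x mod d = d - 1)" for x
    by (cases x) (auto simp: L2_def)
  have length_L1: "length L1 = ?n * r" by (simp add: L1_def)
  have length_L2: "length L2 = ?n * (d - r) - (q + 1)"
  proof -
    have "length L2 = card (set L2)"
      unfolding L2_def by (intro distinct_card[symmetric] distinct_filter distinct_product) auto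
    also have "set L2 = {0..<?n} \<times> {r..<d} - {k. k < ?n \<and> k mod d = d - 1} \<times> {d - 1}"
      by (auto simp: L2_def)
    also have "card \<dots> = ?n * (d - r) - (q + 1)"
    proof (subst card_Diff_subset)
      show "finite ({k. k < ?n \<and> k mod d = d - 1} \<times> {d - 1})" by simp
      show "{k. k < ?n \<and> k mod d = d - 1} \<times> {d - 1} \<subseteq> {0..<?n} \<times> {r..<d}" using r by auto
      show "card ({0..<?n} \<times> {r..<d}) - card ({k. k < ?n \<and> k mod d = d - 1} \<times> {d - 1}) =
          ?n * (d - r) - (q + 1)"
        using card_residue_class[of "d - 1" d ?n "Suc q"] r nn by (simp add: card_cartesian_product)
    qed
    finally show ?thesis .
  qed
  have L2_le: "q + 1 \<le> ?n * (d - r)"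
  proof -
    have "q + 1 \<le> Suc q * d + r" using r by (cases d) auto
    also have "\<dots> \<le> ?n * (d - r)" unfolding nn using r by (cases "d - r") auto
    finally show ?thesis .
  qed

  have t_mod: "(k + t k i) mod D = D - 1" "(l + t k i) mod D = D - 1"
    if "k mod D = i" "l mod D = i" for k i l
  proof -
    have *: "(x + t k i) mod D = D - 1" if "x mod D = i" for x
    proof -
      have "(x + t k i) mod D = (x mod D + t k i) mod D" by (simp add: mod_simps)
      also have "\<dots> = D - 1"
        unfolding that t_def using D by (auto simp: zmod_minus1)
      finally show ?thesis .
    qed
    show "(k + t k i) mod D = D - 1" "(l + t k i) mod D = D - 1" using * that by auto
  qed
  have t_range: "0 \<le> k + t k i" "k + t k i < int ?n"
    if "k mod D = i" "0 \<le> k" "k < int ?n" for k i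
  proof -
    have i: "0 \<le> i" "i < D" using that D by auto
    then show "k + t k i < int ?n" using that by (simp add: t_def)
    have "D \<le> int ?n" using n by (simp add: D_def)
    show "0 \<le> k + t k i"
    proof (cases "k + (D - 1 - i) < int ?n")
      case False
      then have "int ?n - D < k - i" by linarith
      then show ?thesis using False \<open>D \<le> int ?n\<close> by (simp add: t_def)
    qed (use that i in \<open>simp add: t_def\<close>)
  qed
  \<comment> \<open>For i \<ge> r the forward translation always fits. This matters for the chains
    of width q + 1: the partner of the last element then sits in column (q + 1) D - 1 \<ge> m and is
    killed by B, whereas a backward translation could leave it at q D - 1 < m.\<close>
  have t_large: "t k i = D - 1 - i" if "k mod D = i" "k < int ?n" "int r \<le> i" for k i
  proof -
    have k: "k = k div D * D + i" using that by (simp add: div_mult_mod_eq flip: that(1))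
    have "k div D \<le> int q"
    proof (rule ccontr)
      assume "\<not> ?thesis"
      then have "(int q + 1) * D \<le> k div D * D" using D by (intro mult_right_mono) auto
      with k that int_n show False by linarith
    qed
    then have "k div D * D \<le> int q * D" using D by (intro mult_right_mono) auto
    moreover have "int ?n = int q * D + D + int r" using int_n by (simp add: algebra_simps)
    ultimately have "k + (D - 1 - i) < int ?n" using k D by linarith
    then show ?thesis by (simp add: t_def)
  qed

  have c_end: "coupled D t Ev k i l = 0"
    if l: "l < 0 \<or> int ?m \<le> l" and l': "l + t k i < 0 \<or> int ?m \<le> l + t k i \<or> k mod D \<noteq> i" for k i l
    unfolding coupled_def using Ev0[of k l] Ev0[of "k + t k i" "l + t k i"] l l' by auto
  have Ac: "?A (coupled D t Eu k i l) = coupled D t Ev k i (l - D)" and Bc: "?B (coupled D t Eu k i l) = coupled D t Ev k i l" for k i l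
    by (simp_all add: coupled_def R_map_diff R_map_zero A B algebra_simps)
  have t_bounds: "t k i \<le> D - 1 - i" "- 1 - i \<le> t k i" for k i
    using D by (auto simp: t_def)
  \<comment> \<open>A moves the first element to column i - D; its partner lands in a negative
    column too, since the translation is at most D - 1 - i.\<close>
  have start: "?A (u x 0) = 0" if "snd x < d" for x
  proof -
    have "int (snd x) < D" using that by (simp add: D_def)
    then show ?thesis
      unfolding u_def Ac using t_bounds(1)[of "int (fst x)" "int (snd x)"] by (intro c_end) auto
  qed
  have step: "?A (u x (Suc p)) = v x p" "?B (u x p) = v x p" for x p
    unfolding u_def v_def Ac Bc by (simp_all add: algebra_simps)
  have bf1: "block_form mscale ?A ?B (map Horizontal (replicate (length L1) (Suc (q + 1))))
      (chains u L1 (Suc (q + 1))) (chains v L1 (q + 1))"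
  proof (rule block_form_Horizontal_chains[OF cmat.vector_space_axioms])
    fix x assume "x \<in> set L1"
    then have x: "fst x < ?n" "snd x < r" using L1 by auto
    then show "?A (u x 0) = 0" using start r by auto
    have "int ?m \<le> int (snd x) + int (q + 1) * D" "int ?m \<le> int (q + 1) * D - 1"
      using int_m D by (auto simp: algebra_simps)
    then show "?B (u x (q + 1)) = 0"
      unfolding u_def Bc using t_bounds(2)[of "int (snd x)" "int (fst x)"] by (intro c_end) auto
  qed (simp_all add: step)
  have bf2: "block_form mscale ?A ?B (map Horizontal (replicate (length L2) (Suc q)))
      (chains u L2 (Suc q)) (chains v L2 q)"
  proof (rule block_form_Horizontal_chains[OF cmat.vector_space_axioms])
    fix x assume "x \<in> set L2"
    then have x: "fst x < ?n" "r \<le> snd x" "snd x < d" using L2 by auto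
    then show "?A (u x 0) = 0" using start by auto
    have "int ?m \<le> int (snd x) + int q * D" "int ?m \<le> D - 1 + int q * D"
      using int_m D x by auto
    then show "?B (u x q) = 0"
      unfolding u_def Bc using t_large[of "int (fst x)" "int (snd x)"] x by (intro c_end) auto
  qed (simp_all add: step)
  have AF: "?A (Fu a b) = Fv a (b - 1)" and BF: "?B (Fu a b) = Fv a b" for a b
    by (simp_all add: Fu_def Fv_def A B algebra_simps)
  have Fv0: "Fv a b = 0" if "b \<le> - 1 \<or> int q \<le> b" for a b
  proof -
    have "b * D \<le> - 1 * D \<or> int q * D \<le> b * D"
      using that D by (metis mult_right_mono less_imp_le)
    then have "D - 1 + b * D < 0 \<or> int ?m \<le> D - 1 + b * D" using D int_m by linarith
    then show ?thesis unfolding Fv_def by (intro Ev0) blast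
  qed
  have Fu0: "Fu a b = 0" if "b \<le> - 1 \<or> int q + 1 \<le> b" for a b
  proof -
    have "b * D \<le> - 1 * D \<or> (int q + 1) * D \<le> b * D"
      using that D by (metis mult_right_mono less_imp_le)
    then have "D - 1 + b * D < 0 \<or> int ?n \<le> D - 1 + b * D" using D int_n by linarith
    then show ?thesis unfolding Fu_def by (intro Eu0) blast
  qed
  have bf3: "block_form mscale ?A ?B (map Horizontal (replicate (length [0..<q]) (Suc (q + 1))))
      (chains u' [0..<q] (Suc (q + 1))) (chains v' [0..<q] (q + 1))"
    by (rule block_form_Horizontal_chains[OF cmat.vector_space_axioms])
      (simp_all add: u'_def v'_def R_map_diff AF BF Fv0)

  define us where "us = chains u L1 (Suc (q + 1)) @ chains u L2 (Suc q) @ chains u' [0..<q] (Suc (q + 1))"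
  define vs where "vs = chains v L1 (q + 1) @ chains v L2 q @ chains v' [0..<q] (q + 1)"
  define hs where "hs = replicate (length L1) (Suc (q + 1)) @ replicate (length L2) (Suc q) @ replicate q (Suc (q + 1))"
  have bf: "block_form mscale ?A ?B (map Horizontal hs) us vs"
    unfolding us_def vs_def hs_def map_append
    using bf1 bf2 bf3 by (intro block_form_append cmat.vector_space_axioms) auto

  \<comment> \<open>A unit is recovered from its coupled version by adding a unit of the reference
    class. The family X is arbitrary so that the argument serves both sl(n) and the target
    space.\<close>
  have F_in: "X k l \<in> cmat.span S"
    if S: "\<And>a b. 0 \<le> a \<Longrightarrow> a \<le> int q \<Longrightarrow> X (D - 1 + a * D) (D - 1 + b * D) \<in> cmat.span S"
      and S': "\<And>k l. 0 \<le> k \<Longrightarrow> k < int ?n \<Longrightarrow> 0 \<le> l \<Longrightarrow> l < N \<Longrightarrow> \<not> (k mod D = D - 1 \<and> l mod D = D - 1) \<Longrightarrow>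
        coupled D t X k (l mod D) l \<in> cmat.span S"
      and kl: "0 \<le> k" "k < int ?n" "0 \<le> l" "l < N" for X :: "int \<Rightarrow> int \<Rightarrow> complex^'l::finite^'n" and S N k l
  proof -
    have F: "X k l \<in> cmat.span S" if "k mod D = D - 1" "l mod D = D - 1" "0 \<le> k" "k < int ?n" for k l
    proof -
      have kl: "k = D - 1 + k div D * D" "l = D - 1 + l div D * D"
        using that by (metis add.commute div_mult_mod_eq)+
      have "k div D \<le> int q"
      proof (rule ccontr)
        assume "\<not> ?thesis"
        then have "(int q + 1) * D \<le> k div D * D" using D by (intro mult_right_mono) auto
        with kl(1) that int_n D show False by linarith
      qed
      moreover have "0 \<le> k div D" using that D by (simp add: pos_imp_zdiv_nonneg_iff)
      ultimately show ?thesis using S[of "k div D" "l div D"] kl by simp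
    qed
    show ?thesis
    proof (cases "k mod D = D - 1 \<and> l mod D = D - 1")
      case True
      then show ?thesis using F kl by auto
    next
      case False
      show ?thesis
      proof (cases "k mod D = l mod D")
        case True
        have "X (k + t k (l mod D)) (l + t k (l mod D)) \<in> cmat.span S"
          using True t_mod[of k "l mod D" l] t_range[of k "l mod D"] kl by (intro F) auto
        then show ?thesis
          using cmat.span_add[OF S'[OF kl False]] True by (fastforce simp: coupled_def)
      next
        case F: False
        then show ?thesis using S'[OF kl False] by (simp add: coupled_def)
      qed
    qed
  qed
  have split: "\<exists>x\<in>set (if nat (l mod D) < r then L1 else L2). \<exists>p.
      int (fst x) = k \<and> int (snd x) = l mod D \<and> l = int (snd x) + int p * D"
    if "0 \<le> k" "k < int ?n" "0 \<le> l" "\<not> (k mod D = D - 1 \<and> l mod D = D - 1)" for k l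
  proof (intro bexI[of _ "(nat k, nat (l mod D))"] exI[of _ "nat (l div D)"] conjI)
    have l: "0 \<le> l mod D" "l mod D < D" "0 \<le> l div D" using D that by (auto simp: pos_imp_zdiv_nonneg_iff)
    show "l = int (snd (nat k, nat (l mod D))) + int (nat (l div D)) * D"
      using l by simp
    have "int (nat k mod d) = k mod D" using that by (simp add: D_def zmod_int)
    then show "(nat k, nat (l mod D)) \<in> set (if nat (l mod D) < r then L1 else L2)"
      using that l by (auto simp: L1 L2 D_def of_nat_diff)
  qed (use that D in auto)

  have "cmat.span (set vs) = UNIV"
  proof (rule span_eq_UNIV_if_emat[OF e f])
    fix k l assume kl: "0 \<le> k" "k < int ?n" "0 \<le> l" "l < int ?m"
    have "Ev k l \<in> cmat.span (set vs)"
    proof (rule F_in[OF _ _ kl])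
      fix a b assume a: "0 \<le> a" "a \<le> int q"
      have "Fv a b \<in> cmat.span (set vs)"
      proof (cases "0 \<le> b \<and> b < int q")
        case True
        \<comment> \<open>The array of \<open>Fv\<close> has q + 1 rows but only q columns, so every
          diagonal reaches a zero column.\<close>
        show ?thesis
        proof (rule cmat.diagonal_span[of "int q" "int q - 1"])
          fix a b assume ab: "0 \<le> a" "a < int q" "-1 \<le> b" "b \<le> int q - 1"
          have "Fv a b - Fv (a + 1) (b + 1) = v' (nat a) (nat (b + 1))"
            using ab by (simp add: v'_def)
          moreover have "v' (nat a) (nat (b + 1)) \<in> set (chains v' [0..<q] (q + 1))"
            using ab by (intro mem_chains) auto
          ultimately show "Fv a b - Fv (a + 1) (b + 1) \<in> cmat.span (set vs)"
            by (auto simp: vs_def intro: cmat.span_base)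
        qed (use True a Fv0 in auto)
      next
        case False
        then show ?thesis using Fv0[of b a] by (auto intro: cmat.span_zero)
      qed
      then show "Ev (D - 1 + a * D) (D - 1 + b * D) \<in> cmat.span (set vs)" by (simp add: Fv_def)
    next
      fix k l assume kl: "0 \<le> k" "k < int ?n" "0 \<le> l" "l < int ?m" "\<not> (k mod D = D - 1 \<and> l mod D = D - 1)"
      obtain x p where x: "x \<in> set (if nat (l mod D) < r then L1 else L2)" 
        "int (fst x) = k" "int (snd x) = l mod D" "l = int (snd x) + int p * D"
        using split[OF kl(1-3,5)] by blast
      have v: "coupled D t Ev k (l mod D) l = v x p"
          unfolding v_def unfolding x(4)[symmetric] unfolding x(2,3) by (rule refl)
      show "coupled D t Ev k (l mod D) l \<in> cmat.span (set vs)"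
      proof (cases "nat (l mod D) < r")
        case True
        have "int p * D < (int q + 1) * D" using x(4) kl(4) int_m D unfolding distrib_right by linarith
        then have "p < q + 1" using D by (simp add: mult_less_cancel_right)
        then have "v x p \<in> set (chains v L1 (q + 1))" using x(1) True by (intro mem_chains) simp_all
        then show ?thesis unfolding v by (auto simp: vs_def intro: cmat.span_base)
      next
        case False
        have "int p * D < int q * D" using x(3,4) kl(4) int_m False unfolding distrib_right by linarith
        then have "p < q" using D by (simp add: mult_less_cancel_right)
        then have "v x p \<in> set (chains v L2 q)" using x(1) False by (intro mem_chains) simp_all
        then show ?thesis unfolding v by (auto simp: vs_def intro: cmat.span_base)
      qed
    qed
    then show "emat e f k l \<in> cmat.span (set vs)" by (simp add: Ev_def)
  qed
  moreover have "length vs = ?n * ?m"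
  proof -
    \<comment> \<open>In the target the exchange keeps the number of vectors: q chains of length q +
      1 replace q + 1 chains of length q.\<close>
    have "length vs = ?n * r * (q + 1) + (?n * (d - r) - (q + 1)) * q + q * (q + 1)"
      by (simp add: vs_def length_chains length_L1 length_L2)
    also have "\<dots> = ?n * r * (q + 1) + ?n * (d - r) * q"
      using L2_le by (simp add: diff_mult_distrib) (metis add.commute le_add_diff_inverse mult.commute mult_le_mono1 mult_Suc)
    also have "\<dots> = ?n * (r + (r + (d - r)) * q)" by (simp add: algebra_simps)
    also have "\<dots> = ?n * ?m" using r m by (simp add: mult.commute add.commute)
    finally show ?thesis .
  qed
  ultimately have vs: "ordered_basis mscale UNIV vs"
    by (rule ordered_basis_UNIV_by_counting)

  have us: "ordered_basis mscale sl us"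
  proof (rule ordered_basis_sl_by_counting)
    show "Determinants.trace (Fu 0 0) \<noteq> 0"
      using D n by (simp add: Fu_def trace D_def)
    have "Determinants.trace (coupled D t Eu k i l) = 0" if "0 \<le> k" "k < int ?n" "l mod D = i" for k i l
      using t_range[of k i] that unfolding coupled_def
      by (auto simp: trace_sub trace Determinants.trace_def[where A = 0])
    moreover have "Determinants.trace (u' a p) = 0" if "a < q" for a p
    proof -
      have eq: "D - 1 + x * D = D - 1 + y * D \<longleftrightarrow> x = y" for x y :: int using D by simp
      have "(int a + 1) * D \<le> int q * D" using that D by (intro mult_right_mono) auto
      then have "D - 1 + (int a + 1) * D < int ?n" "D - 1 + int a * D < int ?n"
        using int_n D by (simp_all add: algebra_simps)
      then show ?thesis
        using D unfolding u'_def Fu_def trace_sub trace eq by auto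
    qed
    moreover have "(int i + int p * D) mod D = int i" if "i < d" for i p
      using that by (simp add: D_def)
    ultimately show "set us \<subseteq> sl"
      using r D_def unfolding us_def set_append set_chains sl_def u_def by (auto simp: L1 L2)
    show "cmat.span (insert (Fu 0 0) (set us)) = UNIV"
    proof (rule span_eq_UNIV_if_emat[OF e e])
      fix k l assume kl: "0 \<le> k" "k < int ?n" "0 \<le> l" "l < int ?n"
      have "Eu k l \<in> cmat.span (insert (Fu 0 0) (set us))"
      proof (rule F_in[OF _ _ kl])
        fix a b assume a: "0 \<le> a" "a \<le> int q"
        have step: "Fu a b - Fu (a + 1) (b + 1) \<in> cmat.span (insert (Fu 0 0) (set us))"
          if ab: "0 \<le> a" "a < int q" "-1 \<le> b" "b \<le> int q" for a b
        proof -
          have "Fu a b - Fu (a + 1) (b + 1) = u' (nat a) (nat (b + 1))"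
            using ab by (simp add: u'_def)
          moreover have "u' (nat a) (nat (b + 1)) \<in> set (chains u' [0..<q] (Suc (q + 1)))"
            using ab by (intro mem_chains) auto
          ultimately show ?thesis
            by (auto simp: us_def intro: cmat.span_base)
        qed
        have "Fu a b \<in> cmat.span (insert (Fu 0 0) (set us))"
        proof (cases "0 \<le> b \<and> b \<le> int q")
          case True
          \<comment> \<open>In the square array of \<open>Fu\<close> only the main diagonal misses
            both zero columns; it is generated from the adjoined element \<open>Fu 0 0\<close>,
            which carries the trace.\<close>
          show ?thesis
          proof (cases "a = b")
            case False
            show ?thesis
              by (rule cmat.diagonal_span[of "int q" "int q"]) (use True a False step Fu0 in auto)
          next
            case True
            have "Fu a a \<in> cmat.span (insert (Fu 0 0) (set us))"
              by (rule cmat.diagonal_span_insert[of "int q"]) (use a step in \<open>auto intro: cmat.span_base\<close>)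
            with True show ?thesis by simp
          qed
        next
          case False
          then show ?thesis using Fu0[of b a] by (auto intro: cmat.span_zero)
        qed
        then show "Eu (D - 1 + a * D) (D - 1 + b * D) \<in> cmat.span (insert (Fu 0 0) (set us))" by (simp add: Fu_def)
      next
        fix k l assume kl: "0 \<le> k" "k < int ?n" "0 \<le> l" "l < int ?n" "\<not> (k mod D = D - 1 \<and> l mod D = D - 1)"
        obtain x p where x: "x \<in> set (if nat (l mod D) < r then L1 else L2)" 
          "int (fst x) = k" "int (snd x) = l mod D" "l = int (snd x) + int p * D"
          using split[OF kl(1-3,5)] by blast
        have u: "coupled D t Eu k (l mod D) l = u x p"
          unfolding u_def unfolding x(4)[symmetric] unfolding x(2,3) by (rule refl)
        show "coupled D t Eu k (l mod D) l \<in> cmat.span (insert (Fu 0 0) (set us))"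
        proof (cases "nat (l mod D) < r")
          case True
          have "int p * D < (int q + 2) * D" using x(4) kl(4) int_n D unfolding distrib_right by linarith
          then have "p < Suc (q + 1)" using D by (simp add: mult_less_cancel_right)
          then have "u x p \<in> set (chains u L1 (Suc (q + 1)))" using x(1) True by (intro mem_chains) simp_all
          then show ?thesis unfolding u by (auto simp: us_def intro: cmat.span_base)
        next
          case False
          have "int p * D < (int q + 1) * D" using x(3,4) kl(4) int_n False unfolding distrib_right by linarith
          then have "p < Suc q" using D by (simp add: mult_less_cancel_right)
          then have "u x p \<in> set (chains u L2 (Suc q))" using x(1) False by (intro mem_chains) simp_all
          then show ?thesis unfolding u by (auto simp: us_def intro: cmat.span_base)
        qed
      qed
      then show "emat e e k l \<in> cmat.span (insert (Fu 0 0) (set us))" by (simp add: Eu_def)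
    qed
    show "length us + 1 = ?n * ?n"
    proof -
      have "length us + 1 = ?n * r * (q + 2) + (?n * (d - r) - (q + 1)) * (q + 1) + (q * (q + 2) + 1)"
        by (simp add: us_def length_chains length_L1 length_L2)
      \<comment> \<open>Here q (q + 2) + 1 = (q + 1)^2: the reference array loses exactly one
        dimension.\<close>
      also have "\<dots> = ?n * r * (q + 2) + ((?n * (d - r) - (q + 1)) * (q + 1) + (q + 1) * (q + 1))"
        by (simp add: algebra_simps)
      also have "\<dots> = ?n * r * (q + 2) + ?n * (d - r) * (q + 1)"
        unfolding distrib_right[symmetric] le_add_diff_inverse2[OF L2_le] by (rule refl)
      also have "\<dots> = ?n * (r + (r + (d - r)) * (q + 1))" by (simp add: algebra_simps)
      also have "\<dots> = ?n * ?n" unfolding nn using r by (simp add: mult.commute add.commute)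
      finally show ?thesis .
    qed
  qed
  show ?thesis
  proof (rule has_algebraic_typeI[OF us vs _ bf])
    show "\<forall>b\<in>set (map Horizontal hs). block_ok b" by (auto simp: hs_def)
    have "mset hs = replicate_mset (?n * (d - r) - (q + 1)) (q + 1) + replicate_mset (?n * r + q) (q + 2)"
      by (rule multiset_eqI) (simp add: hs_def length_L1 length_L2)
    then show "type_of_blocks (map Horizontal hs) =
       \<lparr>jordan_part = {#}, horizontal_indices = replicate_mset (?n * (d - r) - (q + 1)) (q + 1) +
         replicate_mset (?n * r + q) (q + 2), vertical_indices = {#}\<rparr>"
      by (simp add: type_of_blocks_Horizontal)
  qed
qed

section \<open>More copies than the dimension\<close>

text \<open>The reference class is \<open>0\<close>: its \<open>h + 1\<close> chains of height \<open>h + 2\<close> become \<open>h + 2\<close> chains of height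
  \<open>h + 1\<close>.\<close>

lemma has_algebraic_type_vertical:
  fixes e :: "'n::finite \<Rightarrow> nat" and f :: "'m::finite \<Rightarrow> nat" and q r d :: nat
  assumes e: "numbering e" and f: "numbering f"
    and m: "CARD('m) = CARD('n) + d" and n: "CARD('n) = q * d + r" and r: "r < d"
  shows "has_algebraic_type mscale mscale sl UNIV
    (R_map std_rep (shift_mat e f (- int d))) (R_map std_rep (shift_mat e f 0))
    \<lparr>jordan_part = {#}, horizontal_indices = {#}, vertical_indices =
       (if r \<noteq> 0 then replicate_mset (CARD('n) * (d - r) + (q + 2)) (q + 1) +
          replicate_mset (CARD('n) * r - (q + 1)) (q + 2)
        else replicate_mset (q + 1) q + replicate_mset (CARD('n) * d - q) (q + 1))\<rparr>"
proof -
  let ?A = "R_map std_rep (shift_mat e f (- int d))" and ?B = "R_map std_rep (shift_mat e f 0)"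
  let ?n = "CARD('n)" and ?m = "CARD('m)"
  define D where "D = int d"
  define Eu where "Eu = emat e e"
  define Ev where "Ev = emat e f"
  have int_n: "int ?n = int q * D + int r" unfolding n by (simp add: D_def)
  have int_m: "int ?m = int q * D + D + int r" unfolding m n by (simp add: D_def)
  have D: "D > 0" "int r < D" using r by (auto simp: D_def)
  \<comment> \<open>h + 1 is the number of multiples of d below n, that is, the side of the
    reference array in sl(n).\<close>
  define h where "h = (if r \<noteq> 0 then q else q - 1)"
  have q: "r = 0 \<Longrightarrow> q > 0" using n by (cases q) auto
  have hD: "int h * D < int ?n" "int ?n \<le> int h * D + D"
    using int_n D q unfolding h_def by (cases q; auto simp: algebra_simps)+
  have hm: "int h * D + D < int ?m" "int ?m \<le> int h * D + 2 * D"
    using int_n int_m hD D by auto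
  have Eu0: "Eu k l = 0" if "k < 0 \<or> k \<ge> int ?n \<or> l < 0 \<or> l \<ge> int ?n" for k l
    using emat_outside[OF e e that] by (simp add: Eu_def)
  have Ev0: "Ev k l = 0" if "k < 0 \<or> k \<ge> int ?n \<or> l < 0 \<or> l \<ge> int ?m" for k l
    using emat_outside[OF e f that] by (simp add: Ev_def)
  \<comment> \<open>The range condition is essential here: for -D \<le> l < 0 the left side is zero,
    but column l + D lies inside the matrix.\<close>
  have A: "?A (Eu k l) = Ev k (l + D)" if "0 \<le> l" "l < int ?n" for k l
    using that by (auto simp: R_map_def std_rep_def Eu_def Ev_def emat_mult_shift[OF e] D_def)
  have B: "?B (Eu k l) = Ev k l" if "0 \<le> l" "l < int ?n" for k l
    using that by (auto simp: R_map_def std_rep_def Eu_def Ev_def emat_mult_shift[OF e])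
  have trace: "Determinants.trace (Eu k l) = (if k = l \<and> 0 \<le> k \<and> k < int ?n then 1 else 0)" for k l
    by (simp add: Eu_def trace_emat[OF e])

  \<comment> \<open>A row k of residue i can always be moved back to k - i \<ge> 0, so one formula
    reaches class 0 for all k.\<close>
  define t where "t = (\<lambda>(k :: int) (i :: int). - i)"
  define u where "u x p = coupled D t Eu (int (fst x)) (int (snd x)) (int (snd x) + int p * D)" for x :: "nat \<times> nat" and p :: nat
  define v where "v x p = coupled D t Ev (int (fst x)) (int (snd x)) (int (snd x) + int p * D)" for x :: "nat \<times> nat" and p :: nat
  define Fu where "Fu a b = Eu (a * D) (b * D)" for a b
  define Fv where "Fv a b = Ev (a * D) (b * D)" for a b
  \<comment> \<open>This time the zero edges are the rows -1 and h + 1, so it is the row index that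
    is shifted: \<open>u' 0 p\<close> is - \<open>Fu\<close> 0 (p + 1) and
    \<open>u' (h + 1) p\<close> is \<open>Fu\<close> h p.\<close>
  define u' where "u' a p = Fu (int a - 1) (int p) - Fu (int a) (int p + 1)" for a p :: nat
  define v' where "v' a p = Fv (int a - 1) (int p) - Fv (int a) (int p + 1)" for a p :: nat

  define ref :: "nat \<times> nat \<Rightarrow> bool" where "ref x \<longleftrightarrow> snd x = 0 \<and> fst x mod d = 0" for x
  define L1 where "L1 = filter (\<lambda>x. \<not> ref x) (List.product [0..<?n] [0..<r])"
  define L2 where "L2 = filter (\<lambda>x. \<not> ref x) (List.product [0..<?n] [r..<d])"
  have L1: "x \<in> set L1 \<longleftrightarrow> fst x < ?n \<and> snd x < r \<and> \<not> ref x" for x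
    by (cases x) (auto simp: L1_def)
  have L2: "x \<in> set L2 \<longleftrightarrow> fst x < ?n \<and> r \<le> snd x \<and> snd x < d \<and> \<not> ref x" for x
    by (cases x) (auto simp: L2_def)
  have card_ref: "card ({k. k < ?n \<and> k mod d = 0} \<times> {0::nat}) = Suc h"
  proof -
    have "?n \<le> Suc h * d" "Suc h * d < ?n + d"
      using hD by (simp_all add: D_def flip: of_nat_mult of_nat_add)
    then show ?thesis
      using card_residue_class[of 0 d ?n "Suc h"] r by (simp add: card_cartesian_product)
  qed
  have length_L: "length (filter (\<lambda>x. \<not> ref x) (List.product [0..<?n] [i..<j])) =
      ?n * (j - i) - (if i = 0 \<and> 0 < j then Suc h else 0)" for i j
  proof -
    have "length (filter (\<lambda>x. \<not> ref x) (List.product [0..<?n] [i..<j])) =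
        card (set (filter (\<lambda>x. \<not> ref x) (List.product [0..<?n] [i..<j])))"
      by (intro distinct_card[symmetric] distinct_filter distinct_product) auto
    also have "set (filter (\<lambda>x. \<not> ref x) (List.product [0..<?n] [i..<j])) =
        {0..<?n} \<times> {i..<j} - (if i = 0 \<and> 0 < j then {k. k < ?n \<and> k mod d = 0} \<times> {0} else {})"
      by (auto simp: ref_def)
    also have "card \<dots> = ?n * (j - i) - (if i = 0 \<and> 0 < j then Suc h else 0)"
    proof (cases "i = 0 \<and> 0 < j")
      case True
      then have "card ({0..<?n} \<times> {i..<j} - {k. k < ?n \<and> k mod d = 0} \<times> {0}) =
          card ({0..<?n} \<times> {i..<j}) - card ({k. k < ?n \<and> k mod d = 0} \<times> {0::nat})"
        by (intro card_Diff_subset) auto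
      with True show ?thesis unfolding card_ref by (simp add: card_cartesian_product)
    next
      case False
      then have "(if i = 0 \<and> 0 < j then {k. k < ?n \<and> k mod d = 0} \<times> {0::nat} else {}) = {}"
        by (rule if_not_P)
      with False show ?thesis by (simp only: if_False Diff_empty) (simp add: card_cartesian_product)
    qed
    finally show ?thesis .
  qed
  \<comment> \<open>Residue 0 is counted among the residues below r exactly when r > 0. So the
    correction falls on the longer chains if r \<noteq> 0 and on the shorter ones if r = 0, which
    explains the two forms of the answer.\<close>
  have length_L1: "length L1 = ?n * r - (if r \<noteq> 0 then q + 1 else 0)"
    unfolding L1_def length_L by (simp add: h_def)
  have length_L2: "length L2 = ?n * (d - r) - (if r = 0 then q else 0)"
    unfolding L2_def length_L using r q by (simp add: h_def)
  have n_q: "q + r \<le> ?n" unfolding n using r by simp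
  have L1_le: "q + 1 \<le> ?n * r" if "r \<noteq> 0"
  proof -
    have "?n * 1 \<le> ?n * r" using that by (intro mult_le_mono2) simp
    then show ?thesis using n_q that by linarith
  qed
  have L2_le: "q \<le> ?n * d"
  proof -
    have "?n * 1 \<le> ?n * d" using r by (intro mult_le_mono2) simp
    then show ?thesis using n_q by linarith
  qed

  have Ac: "?A (coupled D t Eu k i l) = coupled D t Ev k i (l + D)"
    and Bc: "?B (coupled D t Eu k i l) = coupled D t Ev k i l"
    if "0 \<le> i" "i \<le> l" "l < int ?n" for k i l
    using that by (auto simp: coupled_def t_def R_map_diff R_map_zero A B algebra_simps)
  have bf1: "block_form mscale ?A ?B (map Vertical (replicate (length L1) (Suc (q + 1))))
      (chains u L1 (q + 1)) (chains v L1 (Suc (q + 1)))"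
  proof (rule block_form_Vertical_chains[OF cmat.vector_space_axioms])
    fix x p assume "x \<in> set L1" and p: "p < q + 1"
    then have x: "snd x < r" using L1 by auto
    have "int p * D \<le> int q * D" using p D by (intro mult_right_mono) auto
    then have "int (snd x) + int p * D < int ?n" using x int_n by linarith
    moreover have "0 \<le> int p * D" using D by simp
    ultimately show "?A (u x p) = v x (Suc p)" "?B (u x p) = v x p"
      unfolding u_def v_def using Ac[of "int (snd x)" "int (snd x) + int p * D" "int (fst x)"]
        Bc[of "int (snd x)" "int (snd x) + int p * D" "int (fst x)"]
      by (simp_all add: algebra_simps)
  qed
  have bf2: "block_form mscale ?A ?B (map Vertical (replicate (length L2) (Suc q)))
      (chains u L2 q) (chains v L2 (Suc q))"
  proof (rule block_form_Vertical_chains[OF cmat.vector_space_axioms])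
    fix x p assume "x \<in> set L2" and p: "p < q"
    then have x: "int (snd x) < D" using L2 by (auto simp: D_def)
    have "(int p + 1) * D \<le> int q * D" using p D by (intro mult_right_mono) auto
    then have "int p * D + D \<le> int q * D" by (simp add: algebra_simps)
    then have "int (snd x) + int p * D < int ?n" using x int_n by linarith
    moreover have "0 \<le> int p * D" using D by simp
    ultimately show "?A (u x p) = v x (Suc p)" "?B (u x p) = v x p"
      unfolding u_def v_def using Ac[of "int (snd x)" "int (snd x) + int p * D" "int (fst x)"]
        Bc[of "int (snd x)" "int (snd x) + int p * D" "int (fst x)"]
      by (simp_all add: algebra_simps)
  qed
  have F_col: "0 \<le> b * D" "b * D < int ?n" if "0 \<le> b" "b \<le> int h" for b
  proof -
    show "0 \<le> b * D" using that D by simp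
    have "b * D \<le> int h * D" using that D by (intro mult_right_mono) auto
    then show "b * D < int ?n" using hD by linarith
  qed
  have AF: "?A (Fu a b) = Fv a (b + 1)" and BF: "?B (Fu a b) = Fv a b" if "0 \<le> b" "b \<le> int h" for a b
    using F_col[OF that] by (simp_all add: Fu_def Fv_def A B algebra_simps)
  have bf3: "block_form mscale ?A ?B (map Vertical (replicate (length [0..<h + 2]) (Suc h)))
      (chains u' [0..<h + 2] h) (chains v' [0..<h + 2] (Suc h))"
    by (rule block_form_Vertical_chains[OF cmat.vector_space_axioms])
      (simp_all add: u'_def v'_def R_map_diff AF BF algebra_simps)
  have F0: "Fu a b = 0" "Fv a b = 0" if "a \<le> - 1 \<or> int h + 1 \<le> a" for a b
  proof -
    have "a * D \<le> - 1 * D \<or> (int h + 1) * D \<le> a * D"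
      using that D by (metis mult_right_mono less_imp_le)
    then have "a * D < 0 \<or> int ?n \<le> a * D"
      using D hD unfolding distrib_right by linarith
    then show "Fu a b = 0" "Fv a b = 0" unfolding Fu_def Fv_def using Eu0 Ev0 by auto
  qed

  define us where "us = chains u L1 (q + 1) @ chains u L2 q @ chains u' [0..<h + 2] h"
  define vs where "vs = chains v L1 (Suc (q + 1)) @ chains v L2 (Suc q) @ chains v' [0..<h + 2] (Suc h)"
  define hs where "hs = replicate (length L1) (Suc (q + 1)) @ replicate (length L2) (Suc q) @ replicate (h + 2) (Suc h)"
  have bf: "block_form mscale ?A ?B (map Vertical hs) us vs"
    unfolding us_def vs_def hs_def map_append
    using bf1 bf2 bf3 unfolding length_upt diff_zero by (intro block_form_append cmat.vector_space_axioms)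

  have F_in: "X k l \<in> cmat.span S"
    if S: "\<And>a b. 0 \<le> a \<Longrightarrow> a \<le> int h \<Longrightarrow> 0 \<le> b \<Longrightarrow> b * D < N \<Longrightarrow> X (a * D) (b * D) \<in> cmat.span S"
      and S': "\<And>k l. 0 \<le> k \<Longrightarrow> k < int ?n \<Longrightarrow> 0 \<le> l \<Longrightarrow> l < N \<Longrightarrow> \<not> (k mod D = 0 \<and> l mod D = 0) \<Longrightarrow>
        coupled D t X k (l mod D) l \<in> cmat.span S"
      and kl: "0 \<le> k" "k < int ?n" "0 \<le> l" "l < N" for X :: "int \<Rightarrow> int \<Rightarrow> complex^'l::finite^'n" and S N k l
  proof -
    have F: "X k l \<in> cmat.span S"
      if "k mod D = 0" "l mod D = 0" "0 \<le> k" "k < int ?n" "0 \<le> l" "l < N" for k l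
    proof -
      have kl: "k = k div D * D" "l = l div D * D"
        using that by auto
      have "k div D \<le> int h"
      proof (rule ccontr)
        assume "\<not> ?thesis"
        then have "(int h + 1) * D \<le> k div D * D" using D by (intro mult_right_mono) auto
        with kl(1) that hD show False unfolding distrib_right by linarith
      qed
      moreover have "0 \<le> k div D" "0 \<le> l div D" using that D by (simp_all add: pos_imp_zdiv_nonneg_iff)
      ultimately show ?thesis using S[of "k div D" "l div D"] kl that by simp
    qed
    show ?thesis
    proof (cases "k mod D = 0 \<and> l mod D = 0")
      case True
      then show ?thesis using F kl by auto
    next
      case False
      show ?thesis
      proof (cases "k mod D = l mod D")
        case True
        have "X (k - k mod D) (l - l mod D) \<in> cmat.span S"
        proof (rule F)
          have "0 \<le> k mod D" "0 \<le> l mod D" using D by auto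
          then show "k - k mod D < int ?n" "l - l mod D < N" using kl by linarith+
          show "0 \<le> k - k mod D" "0 \<le> l - l mod D" using kl D by (simp_all add: zmod_le_nonneg_dividend)
        qed (simp_all add: mod_diff_right_eq)
        then show ?thesis
          using cmat.span_add[OF S'[OF kl False]] True by (fastforce simp: coupled_def t_def)
      next
        case F: False
        then show ?thesis using S'[OF kl False] by (simp add: coupled_def)
      qed
    qed
  qed
  have split: "\<exists>x\<in>set (if nat (l mod D) < r then L1 else L2). \<exists>p.
      int (fst x) = k \<and> int (snd x) = l mod D \<and> l = int (snd x) + int p * D"
    if "0 \<le> k" "k < int ?n" "0 \<le> l" "\<not> (k mod D = 0 \<and> l mod D = 0)" for k l
  proof (intro bexI[of _ "(nat k, nat (l mod D))"] exI[of _ "nat (l div D)"] conjI)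
    have l: "0 \<le> l mod D" "l mod D < D" "0 \<le> l div D" using D that by (auto simp: pos_imp_zdiv_nonneg_iff)
    show "l = int (snd (nat k, nat (l mod D))) + int (nat (l div D)) * D"
      using l by simp
    have "int (nat k mod d) = k mod D" using that by (simp add: D_def zmod_int)
    then show "(nat k, nat (l mod D)) \<in> set (if nat (l mod D) < r then L1 else L2)"
      using that l by (auto simp: L1 L2 D_def ref_def)
  qed (use that D in auto)

  have "cmat.span (set vs) = UNIV"
  proof (rule span_eq_UNIV_if_emat[OF e f])
    fix k l assume kl: "0 \<le> k" "k < int ?n" "0 \<le> l" "l < int ?m"
    have "Ev k l \<in> cmat.span (set vs)"
    proof (rule F_in[OF _ _ kl])
      fix a b assume a: "0 \<le> a" "a \<le> int h" and b: "0 \<le> b" "b * D < int ?m"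
      have "b * D < (int h + 2) * D" using b(2) hm unfolding distrib_right by linarith
      then have "b \<le> int h + 1" using D by (simp add: mult_less_cancel_right)
      \<comment> \<open>Rows and columns change places compared with m < n: there are h + 1 rows and
        h + 2 columns, and every diagonal reaches a zero row.\<close>
      have "Fv a b \<in> cmat.span (set vs)"
      proof (rule cmat.diagonal_span[where F = "\<lambda>b a. Fv a b" and q = "int h + 1" and Q = "int h"])
        fix b a assume ab: "0 \<le> b" "b < int h + 1" "-1 \<le> a" "a \<le> int h"
        have "Fv a b - Fv (a + 1) (b + 1) = v' (nat (a + 1)) (nat b)"
          using ab by (simp add: v'_def)
        moreover have "v' (nat (a + 1)) (nat b) \<in> set (chains v' [0..<h + 2] (Suc h))"
          using ab by (intro mem_chains) auto
        ultimately show "Fv a b - Fv (a + 1) (b + 1) \<in> cmat.span (set vs)"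
          by (auto simp: vs_def intro: cmat.span_base)
      qed (use a b \<open>b \<le> int h + 1\<close> F0 in auto)
      then show "Ev (a * D) (b * D) \<in> cmat.span (set vs)" by (simp add: Fv_def)
    next
      fix k l assume kl: "0 \<le> k" "k < int ?n" "0 \<le> l" "l < int ?m" "\<not> (k mod D = 0 \<and> l mod D = 0)"
      obtain x p where x: "x \<in> set (if nat (l mod D) < r then L1 else L2)" 
        "int (fst x) = k" "int (snd x) = l mod D" "l = int (snd x) + int p * D"
        using split[OF kl(1-3,5)] by blast
      have v: "coupled D t Ev k (l mod D) l = v x p"
          unfolding v_def unfolding x(4)[symmetric] unfolding x(2,3) by (rule refl)
      show "coupled D t Ev k (l mod D) l \<in> cmat.span (set vs)"
      proof (cases "nat (l mod D) < r")
        case True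
        have "int p * D < (int q + 2) * D" using x(4) kl(4) int_m D unfolding distrib_right by linarith
        then have "p < Suc (q + 1)" using D by (simp add: mult_less_cancel_right)
        then have "v x p \<in> set (chains v L1 (Suc (q + 1)))" using x(1) True by (intro mem_chains) simp_all
        then show ?thesis unfolding v by (auto simp: vs_def intro: cmat.span_base)
      next
        case False
        have "int p * D < (int q + 1) * D" using x(3,4) kl(4) int_m False unfolding distrib_right by linarith
        then have "p < Suc q" using D by (simp add: mult_less_cancel_right)
        then have "v x p \<in> set (chains v L2 (Suc q))" using x(1) False by (intro mem_chains) simp_all
        then show ?thesis unfolding v by (auto simp: vs_def intro: cmat.span_base)
      qed
    qed
    then show "emat e f k l \<in> cmat.span (set vs)" by (simp add: Ev_def)
  qed
  moreover have "length vs = ?n * ?m"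
  proof (cases "r = 0")
    case True
    have "length vs = (?n * d - q) * (q + 1) + q * (q + 1)"
      using True q by (simp add: vs_def length_chains length_L1 length_L2 h_def)
    also have "\<dots> = ?n * d * (q + 1)"
      unfolding distrib_right[symmetric] le_add_diff_inverse2[OF L2_le] by (rule refl)
    also have "\<dots> = ?n * ?m" unfolding m using True n by (simp add: algebra_simps)
    finally show ?thesis .
  next
    case False
    have "length vs = (?n * r - (q + 1)) * (q + 2) + (q + 1) * (q + 2) + ?n * (d - r) * (q + 1)"
      using False by (simp add: vs_def length_chains length_L1 length_L2 h_def)
    also have "\<dots> = ?n * r * (q + 2) + ?n * (d - r) * (q + 1)"
      unfolding distrib_right[symmetric] le_add_diff_inverse2[OF L1_le[OF False]] by (rule refl)
    also have "\<dots> = ?n * (r + (r + (d - r)) * (q + 1))" by (simp add: algebra_simps)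
    also have "\<dots> = ?n * ?m" unfolding m using r n by (simp add: algebra_simps)
    finally show ?thesis .
  qed
  ultimately have vs: "ordered_basis mscale UNIV vs"
    by (rule ordered_basis_UNIV_by_counting)

  have us: "ordered_basis mscale sl us"
  proof (rule ordered_basis_sl_by_counting)
    show "Determinants.trace (Fu 0 0) \<noteq> 0"
      by (simp add: Fu_def trace)
    have "Determinants.trace (coupled D t Eu k i l) = 0" if "0 \<le> k" "k < int ?n" "l mod D = i" for k i l
    proof -
      have "k mod D \<le> k" "0 \<le> k mod D" using that D by (simp_all add: zmod_le_nonneg_dividend)
      then show ?thesis
        using that unfolding coupled_def
        by (auto simp: trace_sub trace Determinants.trace_def[where A = 0] t_def)
    qed
    moreover have "Determinants.trace (u' a p) = 0" if "p < h" for a p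
    proof -
      have "a - 1 = b \<longleftrightarrow> a = b + 1" for a b :: int by auto
      moreover have "x * D = y * D \<longleftrightarrow> x = y" for x y :: int using D by simp
      ultimately show ?thesis
        using F_col[of "int p"] F_col[of "int p + 1"] that unfolding u'_def Fu_def trace_sub trace by auto
    qed
    moreover have "(int i + int p * D) mod D = int i" if "i < d" for i p
      using that by (simp add: D_def)
    ultimately show "set us \<subseteq> sl"
      using r D_def unfolding us_def set_append set_chains sl_def u_def by (auto simp: L1 L2)
    show "cmat.span (insert (Fu 0 0) (set us)) = UNIV"
    proof (rule span_eq_UNIV_if_emat[OF e e])
      fix k l assume kl: "0 \<le> k" "k < int ?n" "0 \<le> l" "l < int ?n"
      have "Eu k l \<in> cmat.span (insert (Fu 0 0) (set us))"
      proof (rule F_in[OF _ _ kl])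
        fix a b assume a: "0 \<le> a" "a \<le> int h" and b: "0 \<le> b" "b * D < int ?n"
        have "b * D < (int h + 1) * D" using b(2) hD unfolding distrib_right by linarith
        then have bh: "b \<le> int h" using D by (simp add: mult_less_cancel_right)
        have step: "Fu a b - Fu (a + 1) (b + 1) \<in> cmat.span (insert (Fu 0 0) (set us))"
          if ab: "0 \<le> b" "b < int h" "-1 \<le> a" "a \<le> int h" for a b
        proof -
          have "Fu a b - Fu (a + 1) (b + 1) = u' (nat (a + 1)) (nat b)"
            using ab by (simp add: u'_def)
          moreover have "u' (nat (a + 1)) (nat b) \<in> set (chains u' [0..<h + 2] h)"
            using ab by (intro mem_chains) auto
          ultimately show ?thesis
            by (auto simp: us_def intro: cmat.span_base)
        qed
        have "Fu a b \<in> cmat.span (insert (Fu 0 0) (set us))"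
        proof (cases "a = b")
          case False
          show ?thesis
            by (rule cmat.diagonal_span[where F = "\<lambda>b a. Fu a b" and q = "int h" and Q = "int h"]) (use a b bh False step F0 in auto)
        next
          case True
          have "Fu a a \<in> cmat.span (insert (Fu 0 0) (set us))"
            by (rule cmat.diagonal_span_insert[of "int h"]) (use a step in \<open>auto intro: cmat.span_base\<close>)
          with True show ?thesis by simp
        qed
        then show "Eu (a * D) (b * D) \<in> cmat.span (insert (Fu 0 0) (set us))" by (simp add: Fu_def)
      next
        fix k l assume kl: "0 \<le> k" "k < int ?n" "0 \<le> l" "l < int ?n" "\<not> (k mod D = 0 \<and> l mod D = 0)"
        obtain x p where x: "x \<in> set (if nat (l mod D) < r then L1 else L2)" 
          "int (fst x) = k" "int (snd x) = l mod D" "l = int (snd x) + int p * D"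
          using split[OF kl(1-3,5)] by blast
        have u: "coupled D t Eu k (l mod D) l = u x p"
          unfolding u_def unfolding x(4)[symmetric] unfolding x(2,3) by (rule refl)
        show "coupled D t Eu k (l mod D) l \<in> cmat.span (insert (Fu 0 0) (set us))"
        proof (cases "nat (l mod D) < r")
          case True
          have "int p * D < (int q + 1) * D" using x(4) kl(4) int_n D unfolding distrib_right by linarith
          then have "p < q + 1" using D by (simp add: mult_less_cancel_right)
          then have "u x p \<in> set (chains u L1 (q + 1))" using x(1) True by (intro mem_chains) simp_all
          then show ?thesis unfolding u by (auto simp: us_def intro: cmat.span_base)
        next
          case False
          have "int p * D < int q * D" using x(3,4) kl(4) int_n False by linarith
          then have "p < q" using D by (simp add: mult_less_cancel_right)
          then have "u x p \<in> set (chains u L2 q)" using x(1) False by (intro mem_chains) simp_all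
          then show ?thesis unfolding u by (auto simp: us_def intro: cmat.span_base)
        qed
      qed
      then show "emat e e k l \<in> cmat.span (insert (Fu 0 0) (set us))" by (simp add: Eu_def)
    qed
    show "length us + 1 = ?n * ?n"
    proof (cases "r = 0")
      case True
      then have "length us + 1 = (?n * d - q) * q + ((q + 1) * (q - 1) + 1)"
        using q by (simp add: us_def length_chains length_L1 length_L2 h_def)
      \<comment> \<open>For r = 0 the reference array has side q, and again exactly one dimension is
        lost.\<close>
      also have "(q + 1) * (q - 1) + 1 = q * q"
        using q[OF True] by (cases q) simp_all
      also have "(?n * d - q) * q + q * q = ?n * d * q"
        unfolding distrib_right[symmetric] le_add_diff_inverse2[OF L2_le] by (rule refl)
      also have "\<dots> = ?n * ?n" using True n by (simp add: algebra_simps)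
      finally show ?thesis .
    next
      case False
      then have "length us + 1 = (?n * r - (q + 1)) * (q + 1) + (q + 1) * (q + 1) + ?n * (d - r) * q"
        by (simp add: us_def length_chains length_L1 length_L2 h_def)
      also have "\<dots> = ?n * r * (q + 1) + ?n * (d - r) * q"
        unfolding distrib_right[symmetric] le_add_diff_inverse2[OF L1_le[OF False]] by (rule refl)
      also have "\<dots> = ?n * (r + (r + (d - r)) * q)" by (simp add: algebra_simps)
      also have "\<dots> = ?n * ?n" using r n by (simp add: algebra_simps)
      finally show ?thesis .
    qed
  qed
  show ?thesis
  proof (rule has_algebraic_typeI[OF us vs _ bf])
    show "\<forall>b\<in>set (map Vertical hs). block_ok b" by (auto simp: hs_def)
    have "mset hs = (if r \<noteq> 0 then replicate_mset (?n * (d - r) + (q + 2)) (q + 1) +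
          replicate_mset (?n * r - (q + 1)) (q + 2)
        else replicate_mset (q + 1) q + replicate_mset (?n * d - q) (q + 1))"
      using q by (cases "r = 0") (auto intro!: multiset_eqI simp: hs_def length_L1 length_L2 h_def)
    then show "type_of_blocks (map Vertical hs) =
       \<lparr>jordan_part = {#}, horizontal_indices = {#}, vertical_indices =
         (if r \<noteq> 0 then replicate_mset (?n * (d - r) + (q + 2)) (q + 1) +
          replicate_mset (?n * r - (q + 1)) (q + 2)
        else replicate_mset (q + 1) q + replicate_mset (?n * d - q) (q + 1))\<rparr>"
      by (simp add: type_of_blocks_Vertical)
  qed
qed

section \<open>As many copies as the dimension\<close>

definition lagrange_numerator :: "('n::finite \<Rightarrow> complex) \<Rightarrow> 'n \<Rightarrow> complex poly" where
  "lagrange_numerator \<mu> k = (\<Prod>i\<in>UNIV - {k}. [:- \<mu> i, 1:])"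

lemma degree_lagrange_numerator: "Polynomial.degree (lagrange_numerator \<mu> k) = CARD('n) - 1"
  for k :: "'n::finite"
proof -
  have "Polynomial.degree (lagrange_numerator \<mu> k) = (\<Sum>i\<in>UNIV - {k}. Polynomial.degree [:- \<mu> i, 1:])"
    unfolding lagrange_numerator_def by (rule degree_prod_eq_sum_degree) simp
  then show ?thesis by (simp add: card_Diff_singleton)
qed

lemma coeff_lagrange_numerator: "Polynomial.coeff (lagrange_numerator \<mu> k) (CARD('n) - 1) = 1"
  for k :: "'n::finite"
proof -
  have "lead_coeff (lagrange_numerator \<mu> k) = 1"
    unfolding lagrange_numerator_def lead_coeff_prod by simp
  then show ?thesis by (simp add: degree_lagrange_numerator)
qed

lemma poly_lagrange_numerator_eq_0_iff:
  fixes \<mu> :: "'n::finite \<Rightarrow> complex"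
  assumes "inj \<mu>"
  shows "poly (lagrange_numerator \<mu> k) (\<mu> l) = 0 \<longleftrightarrow> k \<noteq> l"
proof -
  have "poly (lagrange_numerator \<mu> k) (\<mu> l) = (\<Prod>i\<in>UNIV - {k}. \<mu> l - \<mu> i)"
    by (simp add: lagrange_numerator_def poly_prod)
  then have "poly (lagrange_numerator \<mu> k) (\<mu> l) = 0 \<longleftrightarrow> (\<exists>i\<in>UNIV - {k}. \<mu> l = \<mu> i)"
    by simp
  also have "\<dots> \<longleftrightarrow> k \<noteq> l"
    using assms by (blast dest: injD)
  finally show ?thesis .
qed

lemma lagrange_interpolation:
  fixes \<mu> :: "'n::finite \<Rightarrow> complex"
  assumes inj: "inj \<mu>" and p: "Polynomial.degree p < CARD('n)"
  shows "p = (\<Sum>k\<in>UNIV. Polynomial.smult (poly p (\<mu> k) / poly (lagrange_numerator \<mu> k) (\<mu> k)) (lagrange_numerator \<mu> k))"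
    (is "p = ?q")
proof (rule poly_eqI_degree[of "range \<mu>"])
  show "Polynomial.degree p < card (range \<mu>)" using p by (simp add: card_image[OF inj])
  have "Polynomial.degree ?q \<le> CARD('n) - 1"
    by (intro degree_sum_le) (auto intro: order_trans[OF degree_smult_le] simp: degree_lagrange_numerator)
  then show "Polynomial.degree ?q < card (range \<mu>)" using p by (simp add: card_image[OF inj])
  fix x assume "x \<in> range \<mu>"
  then obtain l where x: "x = \<mu> l" by auto
  have "poly ?q x = (\<Sum>k\<in>UNIV. if k = l then poly p (\<mu> l) else 0)"
    unfolding poly_sum x
    by (intro sum.cong) (use poly_lagrange_numerator_eq_0_iff[OF inj] in auto)
  then show "poly p x = poly ?q x" by (simp add: x)
qed

text \<open>Compare the leading coefficients in the interpolation formula for \<open>x\<^sup>j\<close>.\<close>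

lemma sum_power_lagrange:
  fixes \<mu> :: "'n::finite \<Rightarrow> complex"
  assumes inj: "inj \<mu>" and j: "j < CARD('n)"
  shows "(\<Sum>k\<in>UNIV. \<mu> k ^ j / poly (lagrange_numerator \<mu> k) (\<mu> k)) = (if j = CARD('n) - 1 then 1 else 0)"
proof -
  have "Polynomial.monom 1 j = (\<Sum>k\<in>UNIV. Polynomial.smult (\<mu> k ^ j / poly (lagrange_numerator \<mu> k) (\<mu> k)) (lagrange_numerator \<mu> k))"
    using lagrange_interpolation[OF inj, of "Polynomial.monom 1 j"] j by (simp add: degree_monom_eq poly_monom)
  then have "Polynomial.coeff (Polynomial.monom 1 j) (CARD('n) - 1) =
      Polynomial.coeff (\<Sum>k\<in>UNIV. Polynomial.smult (\<mu> k ^ j / poly (lagrange_numerator \<mu> k) (\<mu> k)) (lagrange_numerator \<mu> k)) (CARD('n) - 1)"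
    by simp
  then show ?thesis
    unfolding coeff_sum coeff_smult coeff_lagrange_numerator coeff_monom mult_1_right by (rule sym)
qed

lemma sum_coeff_times_power:
  assumes "Polynomial.degree p < n"
  shows "(\<Sum>j<n. Polynomial.coeff p j * x ^ j) = poly p (x::complex)"
  unfolding poly_altdef using assms
  by (intro sum.mono_neutral_right) (auto simp: coeff_eq_0)

lemma mset_filter_Jordan:
  "[k. Jordan e' k \<leftarrow> map (\<lambda>x. Jordan (g x) 1) L, e' = e] = replicate (length (filter (\<lambda>x. g x = e) L)) 1"
  by (induction L) simp_all

text \<open>The eigenvalue \<mu> l belongs to the n - 1 labels (k, l) with k \<noteq> l. For n = 1
  there are no such labels, so the eigenvalue leaves no entry in the Jordan part, not even an empty
  one.\<close>

lemma type_of_blocks_square: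
  fixes \<mu> :: "'n::finite \<Rightarrow> complex" and L :: "('n \<times> 'n) list"
  assumes inj: "inj \<mu>" and L: "distinct L" "set L = {(k, l). k \<noteq> l}"
  shows "type_of_blocks (map (\<lambda>x. Jordan (Finite_ev (\<mu> (snd x))) 1) L @ [Vertical CARD('n)]) =
    \<lparr>jordan_part = (if CARD('n) = 1 then {#} else replicate_mset CARD('n) (replicate_mset (CARD('n) - 1) 1)),
     horizontal_indices = {#}, vertical_indices = {#CARD('n)#}\<rparr>"
proof -
  let ?g = "\<lambda>x :: 'n \<times> 'n. Finite_ev (\<mu> (snd x))"
  let ?bs = "map (\<lambda>x. Jordan (?g x) 1) L @ [Vertical CARD('n)]"
  have "{e. \<exists>k. Jordan e k \<in> set ?bs} = ?g ` {(k, l). k \<noteq> l}" using L by auto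
  also have "\<dots> = (if CARD('n) = 1 then {} else range (\<lambda>l. Finite_ev (\<mu> l)))"
  proof (cases "CARD('n) = 1")
    case True
    then obtain a :: 'n where "UNIV = {a}" using card_1_singletonE by blast
    then have "k = l" for k l :: 'n by (metis UNIV_I singletonD)
    with True show ?thesis by auto
  next
    case False
    have "\<exists>k :: 'n. k \<noteq> l" for l
    proof (rule ccontr)
      assume "\<not> ?thesis"
      then have "UNIV = {l}" by auto
      with False show False by (metis card.empty card.insert empty_iff finite.emptyI One_nat_def)
    qed
    then have "range (\<lambda>l. Finite_ev (\<mu> l)) \<subseteq> ?g ` {(k, l). k \<noteq> l}"
      by (metis (mono_tags, lifting) case_prodI image_eqI image_subsetI mem_Collect_eq snd_conv)
    with False show ?thesis by auto
  qed
  finally have ev: "{e. \<exists>k. Jordan e k \<in> set ?bs} = (if CARD('n) = 1 then {} else range (\<lambda>l. Finite_ev (\<mu> l)))" .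
  have "[k. Jordan e' k \<leftarrow> ?bs, e' = e] = replicate (CARD('n) - 1) 1" if "e \<in> range (\<lambda>l. Finite_ev (\<mu> l))" for e
  proof -
    obtain l where e: "e = Finite_ev (\<mu> l)" using \<open>e \<in> _\<close> by auto
    have "length (filter (\<lambda>x. ?g x = e) L) = card (set (filter (\<lambda>x. ?g x = e) L))"
      using L by (intro distinct_card[symmetric]) simp
    also have "set (filter (\<lambda>x. ?g x = e) L) = (UNIV - {l}) \<times> {l}"
      using L inj by (auto simp: e inj_eq)
    finally have "length (filter (\<lambda>x. ?g x = e) L) = CARD('n) - 1" by (simp add: card_cartesian_product card_Diff_singleton)
    then show ?thesis using mset_filter_Jordan[of e ?g L] by simp
  qed
  then have "image_mset (\<lambda>e. mset [k. Jordan e' k \<leftarrow> ?bs, e' = e]) (mset_set {e. \<exists>k. Jordan e k \<in> set ?bs})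
      = image_mset (\<lambda>e. replicate_mset (CARD('n) - 1) 1) (mset_set {e. \<exists>k. Jordan e k \<in> set ?bs})"
    unfolding ev by (intro image_mset_cong) (auto split: if_splits)
  also have "\<dots> = (if CARD('n) = 1 then {#} else replicate_mset CARD('n) (replicate_mset (CARD('n) - 1) 1))"
  proof -
    have "card (range (\<lambda>l. Finite_ev (\<mu> l))) = CARD('n)"
      using inj by (intro card_image) (auto simp: inj_def)
    then show ?thesis unfolding ev by (simp add: image_mset_const_eq)
  qed
  finally have "image_mset (\<lambda>e. mset [k. Jordan e' k \<leftarrow> ?bs, e' = e]) (mset_set {e. \<exists>k. Jordan e k \<in> set ?bs})
      = (if CARD('n) = 1 then {#} else replicate_mset CARD('n) (replicate_mset (CARD('n) - 1) 1))" .
  moreover have "[h. Horizontal h \<leftarrow> map (\<lambda>x. Jordan (?g x) 1) L] = []" "[h. Vertical h \<leftarrow> map (\<lambda>x. Jordan (?g x) 1) L] = []"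
    by (induction L) simp_all
  ultimately show ?thesis by (simp add: type_of_blocks_def)
qed

text \<open>A diagonal matrix whose rows and columns carry different index types, identified by
  \<sigma>.\<close>

definition diag_pencil :: "('n \<Rightarrow> 'm) \<Rightarrow> ('n \<Rightarrow> complex) \<Rightarrow> complex^'m^'n" where
  "diag_pencil \<sigma> \<mu> = (\<chi> i j. if \<sigma> i = j then \<mu> i else 0)"

lemma unit_mat_mult_diag_pencil:
  fixes \<sigma> :: "'n::finite \<Rightarrow> 'm::finite"
  assumes "bij \<sigma>"
  shows "unit_mat (k, l) ** diag_pencil \<sigma> \<mu> = mscale (\<mu> l) (unit_mat (k, \<sigma> l))"
proof -
  have "(unit_mat (k, l) ** diag_pencil \<sigma> \<mu>) $ i $ j = mscale (\<mu> l) (unit_mat (k, \<sigma> l)) $ i $ j" for i j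
  proof -
    have "(unit_mat (k, l) ** diag_pencil \<sigma> \<mu>) $ i $ j =
        (\<Sum>x\<in>UNIV. if x = l then (if k = i \<and> \<sigma> l = j then \<mu> l else 0) else 0)"
      unfolding matrix_matrix_mult_def unit_mat_nth diag_pencil_def vec_lambda_beta
      by (intro sum.cong) auto
    then show ?thesis by (simp add: mscale_def unit_mat_nth)
  qed
  then show ?thesis by (simp add: Finite_Cartesian_Product.vec_eq_iff)
qed

text \<open>An off-diagonal matrix unit \<open>E\<^sub>k\<^sub>l\<close> is a Jordan block with eigenvalue \<open>\<mu>\<^sub>l\<close>. The diagonal matrices form
  one vertical chain, starting at the vector whose power sums of degree less than \<open>n - 1\<close> vanish.\<close>

lemma has_algebraic_type_square:
  fixes \<sigma> :: "'n::finite \<Rightarrow> 'm::finite" and \<mu> :: "'n \<Rightarrow> complex"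
  assumes \<sigma>: "bij \<sigma>" and inj: "inj \<mu>"
  shows "has_algebraic_type mscale mscale sl UNIV
    (R_map std_rep (diag_pencil \<sigma> \<mu>)) (R_map std_rep (diag_pencil \<sigma> (\<lambda>_. 1)))
    \<lparr>jordan_part = (if CARD('n) = 1 then {#} else replicate_mset CARD('n) (replicate_mset (CARD('n) - 1) 1)),
     horizontal_indices = {#}, vertical_indices = {#CARD('n)#}\<rparr>"
proof -
  let ?A = "R_map std_rep (diag_pencil \<sigma> \<mu>)" and ?B = "R_map std_rep (diag_pencil \<sigma> (\<lambda>_. 1))"
  let ?n = "CARD('n)"
  have cm: "?n = CARD('m)" using \<sigma> by (rule bij_betw_same_card)
  have "finite {(k, l :: 'n). k \<noteq> l}" by simp
  then obtain L :: "('n \<times> 'n) list" where L: "distinct L" "set L = {(k, l). k \<noteq> l}"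
    using finite_distinct_list by metis
  have length_L: "length L + ?n = ?n * ?n"
  proof -
    have "length L = card (UNIV - range (\<lambda>k :: 'n. (k, k)))"
      unfolding distinct_card[OF L(1), symmetric] L(2) by (intro arg_cong[of _ _ card]) auto
    also have "\<dots> = ?n * ?n - ?n"
      by (subst card_Diff_subset) (auto simp: card_image inj_on_def)
    finally show ?thesis by (simp add: le_square)
  qed
  \<comment> \<open>With these weights the trace of \<open>u j\<close> is a power sum of the kind
    evaluated in \<open>sum_power_lagrange\<close>: 0 for j < n - 1 and 1 for j = n - 1.\<close>
  define c where "c k = 1 / poly (lagrange_numerator \<mu> k) (\<mu> k)" for k
  define u :: "nat \<Rightarrow> complex^'n^'n" where "u j = (\<Sum>k\<in>UNIV. mscale (\<mu> k ^ j * c k) (unit_mat (k, k)))" for j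
  define v :: "nat \<Rightarrow> complex^'m^'n" where "v j = (\<Sum>k\<in>UNIV. mscale (\<mu> k ^ j * c k) (unit_mat (k, \<sigma> k)))" for j
  have A: "?A (unit_mat (k, l)) = mscale (\<mu> l) (unit_mat (k, \<sigma> l))"
    and B: "?B (unit_mat (k, l)) = unit_mat (k, \<sigma> l)" for k l
    using unit_mat_mult_diag_pencil[OF \<sigma>, of k l] unit_mat_mult_diag_pencil[OF \<sigma>, of k l "\<lambda>_. 1"]
    by (simp_all add: R_map_def std_rep_def)
  interpret A: Vector_Spaces.linear mscale mscale ?A by (rule linear_R_map_std_rep)
  interpret B: Vector_Spaces.linear mscale mscale ?B by (rule linear_R_map_std_rep)
  have Au: "?A (u j) = v (Suc j)" and Bu: "?B (u j) = v j" for j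
    unfolding u_def v_def A.sum B.sum A.scale B.scale A B by (simp_all add: mult_ac)
  define us where "us = concat (map (\<lambda>x. [unit_mat x]) L) @ map u [0..<?n - 1]"
  define vs where "vs = concat (map (\<lambda>x. [unit_mat (fst x, \<sigma> (snd x))]) L) @ map v [0..<Suc (?n - 1)]"
  have bf: "block_form mscale ?A ?B (map (\<lambda>x. Jordan (Finite_ev (\<mu> (snd x))) 1) L @ [Vertical (Suc (?n - 1))]) us vs"
    unfolding us_def vs_def
    by (intro block_form_append block_form_concat block_form_Jordan_1 block_form_Vertical cmat.vector_space_axioms)
      (auto simp: A B Au Bu)
  \<comment> \<open>Recovers the diagonal units from the moments: combining the moments with the
    coefficients of a polynomial g multiplies the weight of X i by g (\<mu> i), and the k-th
    Lagrange numerator leaves only X k, with total factor 1.\<close>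
  have diag: "(\<Sum>j<?n. mscale (Polynomial.coeff (lagrange_numerator \<mu> k) j) (\<Sum>i\<in>UNIV. mscale (\<mu> i ^ j * c i) (X i))) = X k"
    for k and X :: "'n \<Rightarrow> complex^'l^'n"
  proof -
    have "(\<Sum>j<?n. mscale (Polynomial.coeff (lagrange_numerator \<mu> k) j) (\<Sum>i\<in>UNIV. mscale (\<mu> i ^ j * c i) (X i)))
        = (\<Sum>i\<in>UNIV. \<Sum>j<?n. mscale (Polynomial.coeff (lagrange_numerator \<mu> k) j * \<mu> i ^ j * c i) (X i))"
      unfolding cmat.scale_sum_right by (subst sum.swap) (simp add: mult.assoc)
    also have "\<dots> = (\<Sum>i\<in>UNIV. mscale (poly (lagrange_numerator \<mu> k) (\<mu> i) * c i) (X i))"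
      by (simp add: degree_lagrange_numerator flip: sum_coeff_times_power[where n = ?n] cmat.scale_sum_left sum_distrib_right)
    also have "\<dots> = (\<Sum>i\<in>UNIV. if i = k then X k else 0)"
      using poly_lagrange_numerator_eq_0_iff[OF inj] by (intro sum.cong) (auto simp: c_def)
    finally show ?thesis by simp
  qed
  have "cmat.span (set vs) = UNIV"
  proof (rule span_eq_UNIV_if_unit_mat, rule subsetI)
    fix x :: "complex^'m^'n" assume "x \<in> range unit_mat"
    then obtain k j where kj: "x = unit_mat (k, j)" by auto
    obtain l where l: "j = \<sigma> l" using \<sigma> by (metis bij_pointE)
    show "x \<in> cmat.span (set vs)"
    proof (cases "k = l")
      case False
      then have "x \<in> set vs" using L(2) by (force simp: kj l vs_def)
      then show ?thesis by (rule cmat.span_base)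
    next
      case True
      have "x = (\<Sum>j<?n. mscale (Polynomial.coeff (lagrange_numerator \<mu> k) j) (v j))"
        unfolding v_def diag by (simp add: kj l True)
      also have "\<dots> \<in> cmat.span (set vs)"
        by (intro cmat.span_sum cmat.span_scale cmat.span_base) (auto simp: vs_def)
      finally show ?thesis .
    qed
  qed
  moreover have "length vs = ?n * CARD('m)"
    using length_L by (simp add: vs_def length_concat o_def sum_list_triv flip: cm)
  ultimately have vs: "ordered_basis mscale UNIV vs"
    by (rule ordered_basis_UNIV_by_counting)
  have us: "ordered_basis mscale sl us"
  proof (rule ordered_basis_sl_by_counting)
    have trace: "Determinants.trace (u j) = (if j = ?n - 1 then 1 else 0)" if "j < ?n" for j
    proof -
      have "Determinants.trace (u j) = (\<Sum>i\<in>UNIV. \<Sum>k\<in>UNIV. if k = i then \<mu> i ^ j * c i else 0)"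
        unfolding Determinants.trace_def u_def sum_component
        by (intro sum.cong) (auto simp: mscale_def unit_mat_nth)
      also have "\<dots> = (\<Sum>i\<in>UNIV. \<mu> i ^ j / poly (lagrange_numerator \<mu> i) (\<mu> i))"
        by (simp add: c_def)
      finally show ?thesis unfolding sum_power_lagrange[OF inj that] .
    qed
    \<comment> \<open>The moment following the chain supplies the missing direction outside
      sl(n).\<close>
    show "Determinants.trace (u (?n - 1)) \<noteq> 0" using trace by simp
    have "Determinants.trace (unit_mat (k, l) :: complex^'n^'n) = 0" if "k \<noteq> l" for k l
      using that by (auto simp: Determinants.trace_def unit_mat_nth intro!: sum.neutral)
    then show "set us \<subseteq> sl"
      using trace L(2) by (auto simp: us_def sl_def)
    show "cmat.span (insert (u (?n - 1)) (set us)) = UNIV"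
    proof (rule span_eq_UNIV_if_unit_mat, rule subsetI)
      fix x :: "complex^'n^'n" assume "x \<in> range unit_mat"
      then obtain k l where kl: "x = unit_mat (k, l)" by auto
      show "x \<in> cmat.span (insert (u (?n - 1)) (set us))"
      proof (cases "k = l")
        case False
        then have "x \<in> set us" using L(2) by (force simp: kl us_def)
        then show ?thesis by (intro cmat.span_base) simp
      next
        case True
        have "x = (\<Sum>j<?n. mscale (Polynomial.coeff (lagrange_numerator \<mu> k) j) (u j))"
          unfolding u_def diag by (simp add: kl True)
        also have "\<dots> \<in> cmat.span (insert (u (?n - 1)) (set us))"
        proof (intro cmat.span_sum cmat.span_scale cmat.span_base)
          fix j assume "j \<in> {..<?n}"
          then have "j = ?n - 1 \<or> j < ?n - 1" by auto
          then show "u j \<in> insert (u (?n - 1)) (set us)" by (auto simp: us_def)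
        qed
        finally show ?thesis .
      qed
    qed
    have "length us = length L + (?n - 1)"
      by (simp add: us_def length_concat o_def sum_list_triv)
    moreover have "?n > 0" by simp
    ultimately show "length us + 1 = ?n * ?n" using length_L by linarith
  qed
  show ?thesis
    by (rule has_algebraic_typeI[OF us vs _ bf]) (use type_of_blocks_square[OF inj L] in auto)
qed

text \<open>A determinant requires the same index type for rows and columns.\<close>

definition reindex_columns :: "('n \<Rightarrow> 'm) \<Rightarrow> complex^'m^'n \<Rightarrow> complex^'n^'n" where
  "reindex_columns \<sigma> X = (\<chi> i j. X $ i $ \<sigma> j)"

text \<open>The characteristic polynomial det (x b - a) of the pencil. The determinant is taken over
  the polynomial ring, so its coefficients are visibly polynomial in a and b.\<close>

definition pencil_poly :: "complex^'n^'n \<Rightarrow> complex^'n^'n \<Rightarrow> complex poly" where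
  "pencil_poly a b = Determinants.det (\<chi> i j. [:- (a $ i $ j), b $ i $ j:])"

lemma poly_pencil_poly:
  fixes a b :: "complex^'n::finite^'n"
  shows "poly (pencil_poly a b) x = Determinants.det (\<chi> i j. x * b $ i $ j - a $ i $ j)"
  by (simp add: pencil_poly_def Determinants.det_def poly_sum poly_prod)

lemma prod_linear_coeff:
  fixes f g :: "'i \<Rightarrow> complex"
  assumes "finite S"
  shows "Polynomial.degree (\<Prod>i\<in>S. [:f i, g i:]) \<le> card S \<and>
    Polynomial.coeff (\<Prod>i\<in>S. [:f i, g i:]) (card S) = (\<Prod>i\<in>S. g i)"
  using assms
proof (induction S)
  case (insert x S)
  let ?Q = "\<Prod>i\<in>S. [:f i, g i:]"
  have "Polynomial.degree ([:f x, g x:] * ?Q) \<le> Polynomial.degree [:f x, g x:] + Polynomial.degree ?Q"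
    by (rule degree_mult_le)
  also have "\<dots> \<le> Suc (card S)" using insert.IH by simp
  finally have "Polynomial.degree ([:f x, g x:] * ?Q) \<le> Suc (card S)" .
  moreover have "Polynomial.coeff ?Q (Suc (card S)) = 0" using insert.IH by (intro coeff_eq_0) simp
  ultimately show ?case using insert by simp
qed simp

lemma coeff_of_int_mult: "Polynomial.coeff (of_int c * p) k = of_int c * Polynomial.coeff p k"
  by (simp add: of_int_poly)

lemma pencil_poly_coeff:
  fixes a b :: "complex^'n::finite^'n"
  shows "Polynomial.degree (pencil_poly a b) \<le> CARD('n)"
    and "Polynomial.coeff (pencil_poly a b) CARD('n) = Determinants.det b"
proof -
  have *: "Polynomial.degree (\<Prod>i\<in>UNIV. (\<chi> i j. [:- (a $ i $ j), b $ i $ j:]) $ i $ p i) \<le> CARD('n)"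
    "Polynomial.coeff (\<Prod>i\<in>UNIV. (\<chi> i j. [:- (a $ i $ j), b $ i $ j:]) $ i $ p i) CARD('n) = (\<Prod>i\<in>UNIV. b $ i $ p i)"
    for p :: "'n \<Rightarrow> 'n"
    using prod_linear_coeff[OF finite[of "UNIV :: 'n set"], of "\<lambda>i. - (a $ i $ p i)" "\<lambda>i. b $ i $ p i"] by simp_all
  show "Polynomial.degree (pencil_poly a b) \<le> CARD('n)"
    unfolding pencil_poly_def Determinants.det_def
  proof (intro degree_sum_le)
    fix p
    show "Polynomial.degree (of_int (sign p) * (\<Prod>i\<in>UNIV. (\<chi> i j. [:- (a $ i $ j), b $ i $ j:]) $ i $ p i)) \<le> CARD('n)"
      using *(1)[of p] by (intro degree_le) (auto simp: coeff_of_int_mult coeff_eq_0)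
  qed simp
  show "Polynomial.coeff (pencil_poly a b) CARD('n) = Determinants.det b"
    unfolding pencil_poly_def Determinants.det_def coeff_sum coeff_of_int_mult *(2) ..
qed

section \<open>Coefficients and resultants as polynomial functions\<close>

lemma polynomial_functions_coeff_mult:
  assumes "\<And>k. (\<lambda>X. Polynomial.coeff (F X) k) \<in> polynomial_functions s"
    and "\<And>k. (\<lambda>X. Polynomial.coeff (G X) k) \<in> polynomial_functions s"
  shows "(\<lambda>X. Polynomial.coeff (F X * G X) k) \<in> polynomial_functions s"
  unfolding coeff_mult by (intro polynomial_functions_sum polynomial_functions.mult assms)

lemma polynomial_functions_coeff_prod:
  assumes "\<And>i k. i \<in> I \<Longrightarrow> (\<lambda>X. Polynomial.coeff (F i X) k) \<in> polynomial_functions s"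
  shows "(\<lambda>X. Polynomial.coeff (\<Prod>i\<in>I. F i X) k) \<in> polynomial_functions s"
  using assms
proof (induction I arbitrary: k rule: infinite_finite_induct)
  case (insert i I)
  have "(\<lambda>X. Polynomial.coeff (F i X * (\<Prod>i\<in>I. F i X)) k) \<in> polynomial_functions s"
    using insert by (intro polynomial_functions_coeff_mult) auto
  with insert show ?case by simp
qed (simp_all add: polynomial_functions.const)

lemma polynomial_functions_coeff_pencil_poly:
  assumes "\<And>i j. (\<lambda>X. a X $ i $ j) \<in> polynomial_functions s"
    and "\<And>i j. (\<lambda>X. b X $ i $ j) \<in> polynomial_functions s"
  shows "(\<lambda>X. Polynomial.coeff (pencil_poly (a X) (b X)) k) \<in> polynomial_functions s"
proof -
  have a: "(\<lambda>X. - (a X $ i $ j)) \<in> polynomial_functions s" for i j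
    using polynomial_functions_diff[OF polynomial_functions.const[of 0] assms(1)] by simp
  have "(\<lambda>X. Polynomial.coeff [:- (a X $ i $ j), b X $ i $ j:] k) \<in> polynomial_functions s" for i j k
  proof (cases k)
    case (Suc k')
    then show ?thesis using assms(2) by (cases k') (simp_all add: polynomial_functions.const)
  qed (simp add: a)
  then show ?thesis
    unfolding pencil_poly_def Determinants.det_def coeff_sum coeff_of_int_mult vec_lambda_beta
    by (intro polynomial_functions_sum polynomial_functions.mult polynomial_functions.const
        polynomial_functions_coeff_prod)
qed

text \<open>The formal degrees m and n fix the size of the Sylvester matrix. For
  \<open>resultant\<close> itself the size depends on the actual degrees, which may jump with
  X.\<close>

lemma polynomial_functions_resultant_sub:
  assumes "\<And>k. (\<lambda>X. Polynomial.coeff (F X) k) \<in> polynomial_functions s"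
    and "\<And>k. (\<lambda>X. Polynomial.coeff (G X) k) \<in> polynomial_functions s"
  shows "(\<lambda>X. resultant_sub m n (F X) (G X)) \<in> polynomial_functions s"
  unfolding resultant_sub_def det_def'[OF sylvester_mat_sub_carrier]
proof (intro polynomial_functions_sum polynomial_functions.mult polynomial_functions.const polynomial_functions_prod)
  have ite: "(\<lambda>X. if c then f X else g X) \<in> polynomial_functions s"
    if "f \<in> polynomial_functions s" "g \<in> polynomial_functions s" for c f g
    using that by (cases c) simp_all
  fix p i assume "p \<in> {p. p permutes {0..<m + n}}" and i: "i \<in> {0..<m + n}"
  then have ij: "i < m + n" "p i < m + n" using permutes_in_image[of p "{0..<m + n}" i] by auto
  show "(\<lambda>X. sylvester_mat_sub m n (F X) (G X) $$ (i, p i)) \<in> polynomial_functions s"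
    unfolding sylvester_mat_sub_index[OF ij] by (intro ite assms polynomial_functions.const)
qed

text \<open>The rows of G are left null vectors of \<mu> i b - a, hence left eigenvectors of a b^-1
  for distinct eigenvalues. They are independent, and G a = diag(\<mu>) G b holds row by row, so h
  can be taken to be G b up to relabelling.\<close>

lemma equivalent_to_diag_pencil:
  fixes a b :: "complex^'m::finite^'n::finite" and \<sigma> :: "'n \<Rightarrow> 'm" and \<mu> :: "'n \<Rightarrow> complex"
  assumes \<sigma>: "bij \<sigma>" and inj: "inj \<mu>" and b: "Determinants.det (reindex_columns \<sigma> b) \<noteq> 0"
    and root: "\<And>i. poly (pencil_poly (reindex_columns \<sigma> a) (reindex_columns \<sigma> b)) (\<mu> i) = 0"
  shows "equivalent_pairs (a, b) (diag_pencil \<sigma> \<mu>, diag_pencil \<sigma> (\<lambda>_. 1))"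
proof -
  define a' where "a' = reindex_columns \<sigma> a"
  define b' where "b' = reindex_columns \<sigma> b"
  let ?\<tau> = "inv_into UNIV \<sigma>"
  have \<tau>: "?\<tau> (\<sigma> i) = i" "\<sigma> (?\<tau> j) = j" for i j
    using \<sigma> by (auto simp: bij_is_inj bij_is_surj surj_f_inv_f)
  have sum_\<sigma>: "(\<Sum>c\<in>UNIV. g c) = (\<Sum>j\<in>UNIV. g (\<sigma> j))" for g :: "'m \<Rightarrow> complex"
    using sum.reindex_bij_betw[OF \<sigma>, of g] by simp
  have "\<exists>w. w \<noteq> 0 \<and> (\<forall>j. (\<Sum>l\<in>UNIV. w $ l * a' $ l $ j) = \<mu> i * (\<Sum>l\<in>UNIV. w $ l * b' $ l $ j))" for i
  proof -
    define M :: "complex^'n^'n" where "M = (\<chi> l j. \<mu> i * b' $ l $ j - a' $ l $ j)"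
    have "Determinants.det (Finite_Cartesian_Product.transpose M) = 0"
      using root[of i] by (simp add: poly_pencil_poly M_def a'_def b'_def Determinants.det_transpose)
    then have "\<not> invertible (Finite_Cartesian_Product.transpose M)" by (simp add: invertible_det_nz)
    then obtain w where w: "w \<noteq> 0" "Finite_Cartesian_Product.transpose M *v w = 0"
      unfolding invertible_left_inverse matrix_left_invertible_ker by blast
    then have "(\<Sum>l\<in>UNIV. M $ l $ j * w $ l) = 0" for j
      by (simp add: matrix_vector_mult_def Finite_Cartesian_Product.transpose_def Finite_Cartesian_Product.vec_eq_iff)
    then have "(\<Sum>l\<in>UNIV. w $ l * a' $ l $ j) = \<mu> i * (\<Sum>l\<in>UNIV. w $ l * b' $ l $ j)" for j
      by (simp add: M_def sum_distrib_left algebra_simps sum_subtractf)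
    with w(1) show ?thesis by blast
  qed
  then obtain w where "\<forall>i. w i \<noteq> 0 \<and>
      (\<forall>j. (\<Sum>l\<in>UNIV. w i $ l * a' $ l $ j) = \<mu> i * (\<Sum>l\<in>UNIV. w i $ l * b' $ l $ j))"
    using choice[of "\<lambda>i w. w \<noteq> 0 \<and>
      (\<forall>j. (\<Sum>l\<in>UNIV. w $ l * a' $ l $ j) = \<mu> i * (\<Sum>l\<in>UNIV. w $ l * b' $ l $ j))"] by blast
  then have w: "\<And>i. w i \<noteq> 0"
    "\<And>i j. (\<Sum>l\<in>UNIV. w i $ l * a' $ l $ j) = \<mu> i * (\<Sum>l\<in>UNIV. w i $ l * b' $ l $ j)"
    by blast+
  define G :: "complex^'n^'n" where "G = (\<chi> i. w i)"
  define N where "N = G ** b'"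
  have Ga: "(G ** a') $ i $ j = \<mu> i * N $ i $ j" for i j
    using w(2)[of i j] by (simp add: N_def G_def matrix_matrix_mult_def)
  have "invertible b'" using b by (simp add: invertible_det_nz b'_def)
  then obtain b'' where b'': "b' ** b'' = Finite_Cartesian_Product.mat 1" unfolding invertible_def by blast
  \<comment> \<open>Multiplying by the inverse of b' turns the pencil into one matrix with left
    eigenvectors w i, to which polynomials can be applied.\<close>
  define C where "C = a' ** b''"
  have GC: "(\<Sum>k\<in>UNIV. w i $ k * C $ k $ l) = \<mu> i * w i $ l" for i l
  proof -
    have "(\<Sum>k\<in>UNIV. w i $ k * C $ k $ l) = (G ** C) $ i $ l"
      by (simp add: G_def matrix_matrix_mult_def)
    also have "\<dots> = (\<Sum>j\<in>UNIV. (G ** a') $ i $ j * b'' $ j $ l)"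
      unfolding C_def matrix_mul_assoc by (simp add: matrix_matrix_mult_def)
    also have "\<dots> = \<mu> i * (N ** b'') $ i $ l"
      unfolding Ga by (simp add: matrix_matrix_mult_def sum_distrib_left mult.assoc)
    also have "N ** b'' = G" by (simp add: N_def b'' flip: matrix_mul_assoc)
    finally show ?thesis by (simp add: G_def)
  qed
  have "c = 0" if "Finite_Cartesian_Product.transpose G *v c = 0" for c
  proof -
    have c: "(\<Sum>i\<in>UNIV. w i $ l * c $ i) = 0" for l
      using that by (simp add: matrix_vector_mult_def Finite_Cartesian_Product.transpose_def
          Finite_Cartesian_Product.vec_eq_iff G_def)
    \<comment> \<open>A relation among the rows w i persists when it is multiplied by a polynomial
      in C. Taking the k-th Lagrange numerator below isolates the k-th term.\<close>
    have g: "(\<Sum>i\<in>UNIV. c $ i * poly g (\<mu> i) * w i $ l) = 0" for g l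
    proof (induction g arbitrary: l)
      case (pCons x g)
      have "(\<Sum>i\<in>UNIV. c $ i * poly (pCons x g) (\<mu> i) * w i $ l) =
          x * (\<Sum>i\<in>UNIV. w i $ l * c $ i) + (\<Sum>i\<in>UNIV. c $ i * poly g (\<mu> i) * (\<mu> i * w i $ l))"
        by (simp add: sum_distrib_left sum.distrib[symmetric] algebra_simps)
      also have "(\<Sum>i\<in>UNIV. c $ i * poly g (\<mu> i) * (\<mu> i * w i $ l)) =
          (\<Sum>k\<in>UNIV. (\<Sum>i\<in>UNIV. c $ i * poly g (\<mu> i) * w i $ k) * C $ k $ l)"
        unfolding GC[symmetric] sum_distrib_left sum_distrib_right
        by (subst sum.swap) (simp add: mult.assoc)
      finally show ?case using c pCons.IH by simp
    qed simp
    have "c $ k = 0" for k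
    proof -
      have "(\<Sum>i\<in>UNIV. if i = k then c $ k * poly (lagrange_numerator \<mu> k) (\<mu> k) * w k $ l else 0) =
          (\<Sum>i\<in>UNIV. c $ i * poly (lagrange_numerator \<mu> k) (\<mu> i) * w i $ l)" for l
        using poly_lagrange_numerator_eq_0_iff[OF inj] by (intro sum.cong) auto
      then have *: "c $ k * poly (lagrange_numerator \<mu> k) (\<mu> k) * w k $ l = 0" for l
        unfolding g by simp
      obtain l where "w k $ l \<noteq> 0" using w(1)[of k] by (auto simp: Finite_Cartesian_Product.vec_eq_iff)
      then show ?thesis using *[of l] poly_lagrange_numerator_eq_0_iff[OF inj, of k k] by simp
    qed
    then show ?thesis by (simp add: Finite_Cartesian_Product.vec_eq_iff)
  qed
  then have "invertible (Finite_Cartesian_Product.transpose G)"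
    unfolding invertible_left_inverse matrix_left_invertible_ker by blast
  then have G: "invertible G"
    by (simp add: invertible_det_nz Determinants.det_transpose)
  \<comment> \<open>G b with its rows relabelled by \<sigma>, which is what the second equation of
    the equivalence forces.\<close>
  define h :: "complex^'m^'m" where "h = (\<chi> c j. (G ** b) $ (?\<tau> c) $ j)"
  have N: "(G ** b) $ i $ \<sigma> j = N $ i $ j" "(G ** a) $ i $ \<sigma> j = (G ** a') $ i $ j" for i j
    by (simp_all add: N_def a'_def b'_def reindex_columns_def matrix_matrix_mult_def)
  have diag: "(diag_pencil \<sigma> \<nu> ** h) $ i $ j = \<nu> i * (G ** b) $ i $ j" for \<nu> i j
  proof -
    have "(diag_pencil \<sigma> \<nu> ** h) $ i $ j = (\<Sum>c\<in>UNIV. if c = \<sigma> i then \<nu> i * (G ** b) $ i $ j else 0)"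
      unfolding matrix_matrix_mult_def[of "diag_pencil \<sigma> \<nu>"]
      unfolding diag_pencil_def h_def vec_lambda_beta
      by (intro sum.cong) (auto simp: \<tau>)
    then show ?thesis by simp
  qed
  have "(G ** a) $ i $ j = (diag_pencil \<sigma> \<mu> ** h) $ i $ j" for i j
    unfolding diag using Ga[of i "?\<tau> j"] N[of i "?\<tau> j"] by (simp add: \<tau>)
  then have "G ** a = diag_pencil \<sigma> \<mu> ** h" by (simp add: Finite_Cartesian_Product.vec_eq_iff)
  moreover have "G ** b = diag_pencil \<sigma> (\<lambda>_. 1) ** h"
    by (simp add: Finite_Cartesian_Product.vec_eq_iff diag)
  moreover have "invertible h"
  proof -
    have "invertible N" unfolding N_def using G \<open>invertible b'\<close> by (rule invertible_mult)
    then obtain N' where N': "N ** N' = Finite_Cartesian_Product.mat 1" unfolding invertible_def by blast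
    define h' :: "complex^'m^'m" where "h' = (\<chi> j c. N' $ (?\<tau> j) $ (?\<tau> c))"
    have "(h ** h') $ c $ d = (Finite_Cartesian_Product.mat 1 :: complex^'m^'m) $ c $ d" for c d
    proof -
      have "(h ** h') $ c $ d = (\<Sum>j\<in>UNIV. N $ (?\<tau> c) $ j * N' $ j $ (?\<tau> d))"
        unfolding matrix_matrix_mult_def[of h] by (simp add: h_def h'_def sum_\<sigma> N \<tau>)
      also have "\<dots> = (N ** N') $ (?\<tau> c) $ (?\<tau> d)" by (simp add: matrix_matrix_mult_def)
      also have "\<dots> = (if c = d then 1 else 0)"
        unfolding N' Finite_Cartesian_Product.mat_def using \<tau>(2) by simp metis
      finally show ?thesis by (simp add: Finite_Cartesian_Product.mat_def)
    qed
    then have "h ** h' = Finite_Cartesian_Product.mat 1" by (simp add: Finite_Cartesian_Product.vec_eq_iff)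
    then show ?thesis unfolding invertible_right_inverse by blast
  qed
  ultimately show ?thesis using G unfolding equivalent_pairs_def by auto
qed

text \<open>The resultant vanishes if and only if the gcd is nonconstant. Over the complex numbers
  such a gcd has a root, and a common root of p and its derivative is a multiple root of p.\<close>

lemma resultant_pderiv_eq_0_iff:
  fixes p :: "complex poly"
  assumes "p \<noteq> 0"
  shows "resultant p (pderiv p) = 0 \<longleftrightarrow> \<not> rsquarefree p"
proof -
  let ?g = "gcd p (pderiv p)"
  have "Polynomial.degree ?g \<noteq> 0 \<longleftrightarrow> (\<exists>x. poly p x = 0 \<and> poly (pderiv p) x = 0)"
  proof
    assume "Polynomial.degree ?g \<noteq> 0"
    then have "\<not> constant (poly ?g)" by (simp add: constant_degree)
    then obtain x where "poly ?g x = 0" using fundamental_theorem_of_algebra by blast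
    then have "[:- x, 1:] dvd ?g" by (simp add: poly_eq_0_iff_dvd)
    then have "[:- x, 1:] dvd p" "[:- x, 1:] dvd pderiv p" by (auto intro: dvd_trans)
    then show "\<exists>x. poly p x = 0 \<and> poly (pderiv p) x = 0" unfolding poly_eq_0_iff_dvd by blast
  next
    assume "\<exists>x. poly p x = 0 \<and> poly (pderiv p) x = 0"
    then obtain x where "[:- x, 1:] dvd p" "[:- x, 1:] dvd pderiv p" unfolding poly_eq_0_iff_dvd by blast
    then have "[:- x, 1:] dvd ?g" by (rule gcd_greatest)
    moreover have "?g \<noteq> 0" using assms by simp
    ultimately have "Polynomial.degree [:- x, 1:] \<le> Polynomial.degree ?g" by (rule dvd_imp_degree_le)
    then show "Polynomial.degree ?g \<noteq> 0" by simp
  qed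
  then show ?thesis by (simp add: resultant_0_gcd rsquarefree_roots)
qed

lemma JK_invariants_square:
  assumes "CARD('m::finite) = CARD('n::finite)"
  shows "JK_invariants mscale mscale sl (std_rep :: _ \<Rightarrow> complex^'m^'n \<Rightarrow> _)
    \<lparr>jordan_part = (if CARD('n) = 1 then {#} else replicate_mset CARD('n) (replicate_mset (CARD('n) - 1) 1)),
     horizontal_indices = {#}, vertical_indices = {#CARD('n)#}\<rparr>"
proof -
  obtain \<sigma> :: "'n \<Rightarrow> 'm" where \<sigma>: "bij \<sigma>"
    using finite_same_card_bij[OF finite[of "UNIV :: 'n set"] finite[of "UNIV :: 'm set"]] assms by auto
  define P where "P X = pencil_poly (reindex_columns \<sigma> (fst X)) (reindex_columns \<sigma> (snd X))"
    for X :: "(complex^'m^'n) \<times> (complex^'m^'n)"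
  \<comment> \<open>Where the first factor is nonzero, the formal degrees n and n - 1 are the true
    ones, and the second factor vanishes exactly for multiple eigenvalues.\<close>
  define g where "g X = Determinants.det (reindex_columns \<sigma> (snd X)) *
    resultant_sub CARD('n) (CARD('n) - 1) (P X) (pderiv (P X))" for X
  have entry: "(\<lambda>X. reindex_columns \<sigma> (fst X) $ i $ j) \<in> polynomial_functions (pscale :: _ \<Rightarrow> (complex^'m^'n) \<times> _ \<Rightarrow> _)"
    "(\<lambda>X. reindex_columns \<sigma> (snd X) $ i $ j) \<in> polynomial_functions (pscale :: _ \<Rightarrow> (complex^'m^'n) \<times> _ \<Rightarrow> _)" for i j
    unfolding reindex_columns_def vec_lambda_beta by (rule polynomial_functions_entry)+
  have "(\<lambda>X. Polynomial.coeff (P X) k) \<in> polynomial_functions pscale" for k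
    unfolding P_def by (intro polynomial_functions_coeff_pencil_poly entry)
  moreover from this have "(\<lambda>X. Polynomial.coeff (pderiv (P X)) k) \<in> polynomial_functions pscale" for k
    unfolding coeff_pderiv by (intro polynomial_functions.mult polynomial_functions.const)
  ultimately have g: "g \<in> polynomial_functions pscale"
    unfolding g_def
    by (intro polynomial_functions.mult polynomial_functions_det entry polynomial_functions_resultant_sub)
  have degree: "Polynomial.degree (P X) = CARD('n)" if "Determinants.det (reindex_columns \<sigma> (snd X)) \<noteq> 0" for X
    using that pencil_poly_coeff[of "reindex_columns \<sigma> (fst X)" "reindex_columns \<sigma> (snd X)"]
      le_degree[of "P X" "CARD('n)"] by (simp add: P_def)
  have P0: "P X \<noteq> 0" if "Determinants.det (reindex_columns \<sigma> (snd X)) \<noteq> 0" for X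
    using degree[OF that] by auto
  have resultant: "resultant_sub CARD('n) (CARD('n) - 1) (P X) (pderiv (P X)) = resultant (P X) (pderiv (P X))"
    if "Determinants.det (reindex_columns \<sigma> (snd X)) \<noteq> 0" for X
    using degree[OF that] by (simp add: resultant_sub degree_pderiv)
  obtain e :: "'n \<Rightarrow> nat" where e: "numbering e" using ex_numbering by blast
  \<comment> \<open>A point of the open set: a diagonal pair with eigenvalues 0, ..., n - 1.\<close>
  define X0 :: "(complex^'m^'n) \<times> (complex^'m^'n)" where
    "X0 = (diag_pencil \<sigma> (\<lambda>i. of_nat (e i)), diag_pencil \<sigma> (\<lambda>_. 1))"
  have "g X0 \<noteq> 0"
  proof -
    have inj: "inj (\<lambda>i. of_nat (e i) :: complex)"
      using e by (auto simp: inj_def numbering_eq)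
    have \<sigma>_eq: "\<sigma> i = \<sigma> j \<longleftrightarrow> i = j" for i j using \<sigma> by (auto simp: bij_is_inj inj_eq)
    have b: "reindex_columns \<sigma> (snd X0) = Finite_Cartesian_Product.mat 1"
      by (simp add: X0_def reindex_columns_def diag_pencil_def Finite_Cartesian_Product.mat_def \<sigma>_eq)
    have P: "P X0 = (\<Prod>i\<in>UNIV. [:- of_nat (e i), 1:])"
      unfolding P_def pencil_poly_def
      by (subst det_diagonal) (simp_all add: X0_def reindex_columns_def diag_pencil_def \<sigma>_eq)
    have "\<not> (poly (P X0) x = 0 \<and> poly (pderiv (P X0)) x = 0)" for x
    proof
      assume x: "poly (P X0) x = 0 \<and> poly (pderiv (P X0)) x = 0"
      then obtain i where i: "x = of_nat (e i)" unfolding P poly_prod by auto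
      \<comment> \<open>By the product rule the derivative at this root equals the value of the
        cofactor, which is nonzero because the eigenvalues are distinct.\<close>
      have "P X0 = [:- of_nat (e i), 1:] * lagrange_numerator (\<lambda>i. of_nat (e i)) i"
        unfolding P lagrange_numerator_def by (simp add: prod.remove[of UNIV i])
      then have "poly (pderiv (P X0)) x = poly (lagrange_numerator (\<lambda>i. of_nat (e i)) i) (of_nat (e i))"
        unfolding i by (simp only: pderiv_mult poly_add poly_mult) (simp add: pderiv_pCons)
      also have "\<dots> \<noteq> 0" using poly_lagrange_numerator_eq_0_iff[OF inj, of i i] by simp
      finally show False using x by simp
    qed
    then have "rsquarefree (P X0)" by (simp add: rsquarefree_roots)
    then show ?thesis using resultant[of X0] P0[of X0] b by (simp add: g_def resultant_pderiv_eq_0_iff)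
  qed
  show ?thesis
  proof (rule JK_invariants_of_dense_orbits[OF zariski_open_nonzero[OF g]])
    show "{X. g X \<noteq> 0} \<noteq> {}" using \<open>g X0 \<noteq> 0\<close> by blast
    fix X assume "X \<in> {X. g X \<noteq> 0}"
    then have det: "Determinants.det (reindex_columns \<sigma> (snd X)) \<noteq> 0" and "rsquarefree (P X)"
      using resultant[of X] P0[of X] by (auto simp: g_def resultant_pderiv_eq_0_iff)
    have "P X \<noteq> 0" by (rule P0[OF det])
    have "Polynomial.degree (P X) =
        Polynomial.degree (Polynomial.smult (lead_coeff (P X)) (\<Prod>z | poly (P X) z = 0. [:- z, 1:]))"
      using complex_poly_decompose_rsquarefree[OF \<open>rsquarefree (P X)\<close>] by simp
    also have "\<dots> = Polynomial.degree (\<Prod>z | poly (P X) z = 0. [:- z, 1:])"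
      using \<open>P X \<noteq> 0\<close> by simp
    also have "\<dots> = (\<Sum>z | poly (P X) z = 0. Polynomial.degree [:- z, 1:])"
      by (rule degree_prod_eq_sum_degree) simp
    finally have "Polynomial.degree (P X) = card {z. poly (P X) z = 0}" by simp
    \<comment> \<open>A squarefree polynomial of degree n has n distinct roots, so they can be
      labelled by the rows.\<close>
    then have "card {z. poly (P X) z = 0} = CARD('n)"
      using degree[OF det] by simp
    then obtain \<mu> :: "'n \<Rightarrow> complex" where \<mu>: "bij_betw \<mu> UNIV {z. poly (P X) z = 0}"
      using finite_same_card_bij[OF finite[of "UNIV :: 'n set"] poly_roots_finite[OF \<open>P X \<noteq> 0\<close>]] by auto
    then have "inj \<mu>" "\<And>i. poly (P X) (\<mu> i) = 0" by (auto simp: bij_betw_def)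
    then have "equivalent_pairs X (diag_pencil \<sigma> \<mu>, diag_pencil \<sigma> (\<lambda>_. 1))"
      using equivalent_to_diag_pencil[OF \<sigma> _ det, of \<mu> "fst X"] by (simp add: P_def)
    with has_algebraic_type_square[OF \<sigma> \<open>inj \<mu>\<close>]
    show "\<exists>A0 B0. equivalent_pairs X (A0, B0) \<and>
      has_algebraic_type mscale mscale sl UNIV (R_map std_rep A0) (R_map std_rep B0)
        \<lparr>jordan_part = (if CARD('n) = 1 then {#} else replicate_mset CARD('n) (replicate_mset (CARD('n) - 1) 1)),
         horizontal_indices = {#}, vertical_indices = {#CARD('n)#}\<rparr>"
      by blast
  qed
qed

section \<open>The Jordan--Kronecker invariants\<close>

theorem theorem3p9:
  fixes n m :: nat
    and \<rho> :: "complex^'n^'n \<Rightarrow> complex^'m^'n \<Rightarrow> complex^'m^'n"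
  assumes n: "n = CARD('n::finite)"
    and m: "m = CARD('m::finite)"
    and \<rho>: "\<rho> = std_rep"
  shows
    "(m < n \<longrightarrow> (\<forall>q r. m = q * (n - m) + r \<and> r < n - m \<longrightarrow>
       (let H = replicate_mset (n * (n - m - r) - (q + 1)) (q + 1) +
                replicate_mset (n * r + q) (q + 2)
        in size H = n * (n - m) - 1 \<and>
           JK_invariants mscale mscale sl \<rho>
             \<lparr> jordan_part = {#}, horizontal_indices = H, vertical_indices = {#} \<rparr>))) \<and>
     (m = n \<longrightarrow>
       JK_invariants mscale mscale sl \<rho>
         \<lparr> jordan_part =
             (if n = 1 then {#} else replicate_mset n (replicate_mset (n - 1) 1)),
           horizontal_indices = {#},
           vertical_indices = {#n#} \<rparr>) \<and>
     (m > n \<longrightarrow> (\<forall>q r. n = q * (m - n) + r \<and> r < m - n \<longrightarrow>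
       (let V = (if r \<noteq> 0 then
                   replicate_mset (n * (m - n - r) + (q + 2)) (q + 1) +
                   replicate_mset (n * r - (q + 1)) (q + 2)
                 else
                   replicate_mset (q + 1) q +
                   replicate_mset (n * (m - n) - q) (q + 1))
        in size V = n * (m - n) + 1 \<and>
           JK_invariants mscale mscale sl \<rho>
             \<lparr> jordan_part = {#}, horizontal_indices = {#}, vertical_indices = V \<rparr>)))"
proof (intro conjI impI allI)
  obtain e :: "'n \<Rightarrow> nat" and f :: "'m \<Rightarrow> nat" where e: "numbering e" and f: "numbering f"
    using ex_numbering by metis
  {
    fix q r assume mn: "m < n" and qr: "m = q * (n - m) + r \<and> r < n - m"
    define d where "d = n - m"
    have d: "CARD('n) = CARD('m) + d" "d > 0" "CARD('m) = q * d + r" "r < d"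
      using mn qr n m by (simp_all add: d_def)
    have nn: "n = q * d + d + r" using d n by simp
    have "JK_invariants mscale mscale sl \<rho> \<lparr>jordan_part = {#},
        horizontal_indices = replicate_mset (n * (d - r) - (q + 1)) (q + 1) + replicate_mset (n * r + q) (q + 2),
        vertical_indices = {#}\<rparr>"
      unfolding \<rho> n
      using JK_invariants_of_rigid_pair[OF shift_pair_rigid[OF e f d(1,2)]
          has_algebraic_type_horizontal[OF e f d(1,3,4)]] by blast
    \<comment> \<open>The natural-number subtraction is not cut off, because q + 1 \<le> n \<le> n
      (d - r).\<close>
    moreover have "n * (d - r) - (q + 1) + (n * r + q) = n * d - 1"
    proof -
      have "q * 1 \<le> q * d" using d by (intro mult_le_mono2) simp
      then have "q + 1 \<le> n" using nn d(2) by linarith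
      also have "n * 1 \<le> n * (d - r)" using d by (intro mult_le_mono2) simp
      finally have "q + 1 \<le> n * (d - r)" by simp
      moreover have "n * (d - r) + n * r = n * d" using d by (simp flip: distrib_left)
      ultimately show ?thesis by linarith
    qed
    ultimately show "let H = replicate_mset (n * (n - m - r) - (q + 1)) (q + 1) + replicate_mset (n * r + q) (q + 2)
        in size H = n * (n - m) - 1 \<and>
           JK_invariants mscale mscale sl \<rho>
             \<lparr> jordan_part = {#}, horizontal_indices = H, vertical_indices = {#} \<rparr>"
      unfolding d_def Let_def by simp
  next
    assume "m = n"
    then show "JK_invariants mscale mscale sl \<rho>
         \<lparr> jordan_part = (if n = 1 then {#} else replicate_mset n (replicate_mset (n - 1) 1)),
           horizontal_indices = {#}, vertical_indices = {#n#} \<rparr>"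
      unfolding \<rho> n using JK_invariants_square[where 'm = 'm and 'n = 'n] n m by simp
  next
    fix q r assume mn: "m > n" and qr: "n = q * (m - n) + r \<and> r < m - n"
    define d where "d = m - n"
    have d: "CARD('m) = CARD('n) + d" "d > 0" "CARD('n) = q * d + r" "r < d"
      using mn qr n m by (simp_all add: d_def)
    have nn: "n = q * d + r" using d n by simp
    let ?V = "if r \<noteq> 0 then replicate_mset (n * (d - r) + (q + 2)) (q + 1) +
          replicate_mset (n * r - (q + 1)) (q + 2)
        else replicate_mset (q + 1) q + replicate_mset (n * d - q) (q + 1)"
    have "JK_invariants mscale mscale sl \<rho>
        \<lparr>jordan_part = {#}, horizontal_indices = {#}, vertical_indices = ?V\<rparr>"
      unfolding \<rho> n
      using JK_invariants_of_rigid_pair[OF shift_pair_rigid_transposed[OF e f d(1,2)]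
          has_algebraic_type_vertical[OF e f d(1,3,4)]] by blast
    moreover have "size ?V = n * d + 1"
    proof -
      have "q * 1 \<le> q * d" using d by (intro mult_le_mono2) simp
      then have le: "q + r \<le> n" using nn by linarith
      show ?thesis
      proof (cases "r = 0")
        case True
        have "n * 1 \<le> n * d" using d by (intro mult_le_mono2) simp
        then have "q \<le> n * d" using le by linarith
        then show ?thesis using True by simp
      next
        case False
        have "n * 1 \<le> n * r" using False by (intro mult_le_mono2) simp
        \<comment> \<open>From q + r \<le> n \<le> n r and r \<ge> 1; this makes the subtraction in
          the multiplicity of q + 2 exact.\<close>
        then have "q + 1 \<le> n * r" using le False by linarith
        moreover have "n * (d - r) + n * r = n * d" using d by (simp flip: distrib_left)
        ultimately have "n * (d - r) + (q + 2) + (n * r - (q + 1)) = n * d + 1" by linarith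
        with False show ?thesis by simp
      qed
    qed
    ultimately show "let V = (if r \<noteq> 0 then
                   replicate_mset (n * (m - n - r) + (q + 2)) (q + 1) +
                   replicate_mset (n * r - (q + 1)) (q + 2)
                 else
                   replicate_mset (q + 1) q +
                   replicate_mset (n * (m - n) - q) (q + 1))
        in size V = n * (m - n) + 1 \<and>
           JK_invariants mscale mscale sl \<rho>
             \<lparr> jordan_part = {#}, horizontal_indices = {#}, vertical_indices = V \<rparr>"
      unfolding d_def Let_def by blast
  }
qed

end
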